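(* Let $(\mathfrak g,\theta)$ be of type AI or AII, with $\mathfrak g=\mathfrak{sl}(V)=\mathfrak k\oplus\mathfrak p$, and let $e\in\mathfrak p$ be a nonzero almost $\mathfrak p$-distinguished nilpotent element whose Young diagram has row lengths $(\lambda_i)_i$. Suppose there exist indices $i_1,i_2$ with $0<\lambda_{i_1}=\lambda_{i_2}-1$. Then the subvariety $\mathfrak C(e)$ is not an irreducible component of $\mathfrak C^{\mathrm{nil}}(\mathfrak p)$.
   Context: Base field $\Bbbk$ algebraically closed of characteristic $0$; $V$ a finite-dimensional vector space; $\theta$ a nontrivial involution of the simple Lie algebra $\mathfrak g=\mathfrak{sl}(V)$ with $\pm1$-eigenspaces $\mathfrak k,\mathfrak p$. Type AI: $\mathfrak k$ is the Lie algebra preserving a nondegenerate symmetric bilinear form $\Phi$ on $V$, and $\mathfrak p=\{x\in\mathfrak{sl}(V):\Phi(xu,v)=\Phi(u,xv)\ \forall u,v\}$. Type AII: the same with $\Phi$ nondegenerate and alternating. $K$ is the connected algebraic subgroup of $SL(V)$ with Lie algebra $\mathfrak k$. $\mathcal N$ is the set of nilpotent elements in $\mathfrak p$; $\mathfrak p^e=\{y\in\mathfrak p:[e,y]=0\}$; $\mathfrak C^{\mathrm{nil}}(\mathfrak p)=\{(x,y)\in\mathcal N\times\mathcal N:[x,y]=0\}$; $\mathfrak C(e)=\overline{K.(e,\mathcal N\cap\mathfrak p^e)}$ (Zariski closure, $K$ acting diagonally). For a normal $\mathfrak{sl}_2$-triple $(e,h,f)$ ($e,f\in\mathfrak p$,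 $h\in\mathfrak k$, $[h,e]=2e$, $[h,f]=-2f$, $[e,f]=h$) let $\mathfrak p(e,0)=\{y\in\mathfrak p^e:[h,y]=0\}$; $e$ is almost $\mathfrak p$-distinguished if $\mathfrak p(e,0)$ contains no nonzero nilpotent element. The Young diagram of $e$ has as row lengths the Jordan block sizes of $e$ on $V$. *)

theory Defs
  imports
    "HOL-Analysis.Abstract_Topology"
    "Jordan_Normal_Form.Jordan_Normal_Form"
begin

text \<open>
  The vector space \<open>V\<close> is \<open>carrier_vec n\<close>, so that endomorphisms of \<open>V\<close> are the elements
  of \<open>carrier_mat n n\<close>.
\<close>

section \<open>Zariski topology\<close>

text \<open>
  The algebra of polynomial functions generated by a set \<open>C\<close> of coordinate functions.
\<close>

inductive_set polynomial_functions :: "('p \<Rightarrow> 'k::comm_ring_1) set \<Rightarrow> ('p \<Rightarrow> 'k) set"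
  for C :: "('p \<Rightarrow> 'k) set" where
  const: "(\<lambda>_. c) \<in> polynomial_functions C"
| coordinate: "f \<in> C \<Longrightarrow> f \<in> polynomial_functions C"
| add: "f \<in> polynomial_functions C \<Longrightarrow> g \<in> polynomial_functions C \<Longrightarrow>
    (\<lambda>p. f p + g p) \<in> polynomial_functions C"
| mult: "f \<in> polynomial_functions C \<Longrightarrow> g \<in> polynomial_functions C \<Longrightarrow>
    (\<lambda>p. f p * g p) \<in> polynomial_functions C"

definition zero_locus :: "'p set \<Rightarrow> ('p \<Rightarrow> 'k::zero) set \<Rightarrow> 'p set" where
  "zero_locus X F = {p \<in> X. \<forall>f\<in>F. f p = 0}"

definition zariski_topology :: "'p set \<Rightarrow> ('p \<Rightarrow> 'k::idom) set \<Rightarrow> 'p topology" where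
  "zariski_topology X C =
     topology (\<lambda>U. \<exists>F \<subseteq> polynomial_functions C. U = X - zero_locus X F)"

lemma istopology_zariski:
  fixes C :: "('p \<Rightarrow> 'k::idom) set"
  shows "istopology (\<lambda>U. \<exists>F \<subseteq> polynomial_functions C. U = X - zero_locus X F)"
  unfolding istopology_def
proof (intro conjI allI impI)
  fix S T
  assume "\<exists>F \<subseteq> polynomial_functions C. S = X - zero_locus X F"
    and "\<exists>F \<subseteq> polynomial_functions C. T = X - zero_locus X F"
  then obtain F G where F: "F \<subseteq> polynomial_functions C" "S = X - zero_locus X F"
    and G: "G \<subseteq> polynomial_functions C" "T = X - zero_locus X G"
    by blast
  let ?H = "(\<lambda>(f, g) p. f p * g p) ` (F \<times> G)"
  have "?H \<subseteq> polynomial_functions C"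
    using F(1) G(1) by (auto intro: polynomial_functions.mult)
  moreover have "S \<inter> T = X - zero_locus X ?H"
  proof (rule Set.set_eqI)
    fix p
    have "(\<forall>h\<in>?H. h p = 0) \<longleftrightarrow> (\<forall>f\<in>F. \<forall>g\<in>G. f p * g p = 0)"
      by simp
    also have "\<dots> \<longleftrightarrow> (\<forall>f\<in>F. f p = 0) \<or> (\<forall>g\<in>G. g p = 0)"
      by auto
    finally have H: "(\<forall>h\<in>?H. h p = 0) \<longleftrightarrow> (\<forall>f\<in>F. f p = 0) \<or> (\<forall>g\<in>G. g p = 0)" .
    have mem: "p \<in> X - zero_locus X E \<longleftrightarrow> p \<in> X \<and> \<not> (\<forall>f\<in>E. f p = 0)" for E :: "('p \<Rightarrow> 'k) set"
      by (auto simp: zero_locus_def)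
    show "p \<in> S \<inter> T \<longleftrightarrow> p \<in> X - zero_locus X ?H"
      unfolding F(2) G(2) Int_iff mem H by argo
  qed
  ultimately show "\<exists>F \<subseteq> polynomial_functions C. S \<inter> T = X - zero_locus X F"
    by blast
next
  fix \<K>
  assume "\<forall>U\<in>\<K>. \<exists>F \<subseteq> polynomial_functions C. U = X - zero_locus X F"
  then obtain F where F: "\<And>U. U \<in> \<K> \<Longrightarrow> F U \<subseteq> polynomial_functions C"
    "\<And>U. U \<in> \<K> \<Longrightarrow> U = X - zero_locus X (F U)"
    by metis
  have "(\<Union>U\<in>\<K>. F U) \<subseteq> polynomial_functions C"
    using F(1) by blast
  moreover have "\<Union>\<K> = X - zero_locus X (\<Union>U\<in>\<K>. F U)"
  proof -
    have "(\<Union>U\<in>\<K>. U) = (\<Union>U\<in>\<K>. X - zero_locus X (F U))"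
      by (rule SUP_cong[OF refl]) (rule F(2))
    also have "\<dots> = X - zero_locus X (\<Union>U\<in>\<K>. F U)"
      unfolding zero_locus_def by auto
    finally show ?thesis by simp
  qed
  ultimately show "\<exists>F \<subseteq> polynomial_functions C. \<Union>\<K> = X - zero_locus X F"
    by blast
qed

lemma openin_zariski:
  "openin (zariski_topology X C) U \<longleftrightarrow>
     (\<exists>F \<subseteq> polynomial_functions C. U = X - zero_locus X F)"
  unfolding zariski_topology_def by (simp add: topology_inverse'[OF istopology_zariski])

lemma topspace_zariski [simp]: "topspace (zariski_topology X (C :: ('p \<Rightarrow> 'k::idom) set)) = X"
proof -
  have "X = X - zero_locus X {\<lambda>_. 1 :: 'k}"
    by (auto simp: zero_locus_def)
  then have "openin (zariski_topology X C) X"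
    unfolding openin_zariski
    by (intro exI[of _ "{\<lambda>_. 1 :: 'k}"]) (auto intro: polynomial_functions.const)
  then show ?thesis
    unfolding topspace_def openin_zariski by blast
qed

lemma closedin_zariski:
  "closedin (zariski_topology X C) Z \<longleftrightarrow>
     (\<exists>F \<subseteq> polynomial_functions C. Z = zero_locus X F)"
proof -
  have *: "X - Z = X - zero_locus X F \<longleftrightarrow> Z = zero_locus X F" if "Z \<subseteq> X" for F :: "('a \<Rightarrow> 'b) set"
    using that by (auto simp: zero_locus_def)
  have **: "zero_locus X F \<subseteq> X" for F :: "('a \<Rightarrow> 'b) set"
    by (auto simp: zero_locus_def)
  show ?thesis
  proof (cases "Z \<subseteq> X")
    case True
    then show ?thesis
      by (simp add: closedin_def openin_zariski *)
  next
    case False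
    then have "Z \<noteq> zero_locus X F" for F :: "('a \<Rightarrow> 'b) set"
      using ** by blast
    with False show ?thesis
      by (simp add: closedin_def)
  qed
qed

definition irreducible_in :: "'p topology \<Rightarrow> 'p set \<Rightarrow> bool" where
  "irreducible_in T S \<longleftrightarrow> S \<subseteq> topspace T \<and> S \<noteq> {} \<and>
     (\<forall>A B. closedin T A \<and> closedin T B \<and> S \<subseteq> A \<union> B \<longrightarrow> S \<subseteq> A \<or> S \<subseteq> B)"

definition irreducible_component :: "'p topology \<Rightarrow> 'p set \<Rightarrow> 'p set \<Rightarrow> bool" where
  "irreducible_component T X Z \<longleftrightarrow> Z \<subseteq> X \<and> irreducible_in T Z \<and>
     (\<forall>Z'. irreducible_in T Z' \<and> Z \<subseteq> Z' \<and> Z' \<subseteq> X \<longrightarrow> Z' = Z)"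

definition mat_coordinates :: "nat \<Rightarrow> ('k mat \<Rightarrow> 'k) set" where
  "mat_coordinates n = {\<lambda>A. A $$ (i, j) | i j. i < n \<and> j < n}"

definition mat_zariski :: "nat \<Rightarrow> 'k::idom mat topology" where
  "mat_zariski n = zariski_topology (carrier_mat n n) (mat_coordinates n)"

definition mat_pair_zariski :: "nat \<Rightarrow> ('k::idom mat \<times> 'k mat) topology" where
  "mat_pair_zariski n = zariski_topology (carrier_mat n n \<times> carrier_mat n n)
     ((\<lambda>c p. c (fst p)) ` mat_coordinates n \<union> (\<lambda>c p. c (snd p)) ` mat_coordinates n)"

section \<open>The Lie algebra \<open>sl(V)\<close> and its involutions\<close>

definition lie_bracket :: "'k::ring mat \<Rightarrow> 'k mat \<Rightarrow> 'k mat" where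
  "lie_bracket x y = x * y - y * x"

definition mat_trace :: "'k::comm_monoid_add mat \<Rightarrow> 'k" where
  "mat_trace A = (\<Sum>i<dim_row A. A $$ (i, i))"

definition sl :: "nat \<Rightarrow> 'k::comm_ring_1 mat set" where
  "sl n = {x \<in> carrier_mat n n. mat_trace x = 0}"

definition nontrivial_involution :: "nat \<Rightarrow> ('k::comm_ring_1 mat \<Rightarrow> 'k mat) \<Rightarrow> bool" where
  "nontrivial_involution n \<theta> \<longleftrightarrow>
     (\<forall>x\<in>sl n. \<theta> x \<in> sl n) \<and>
     (\<forall>x\<in>sl n. \<forall>y\<in>sl n. \<theta> (x + y) = \<theta> x + \<theta> y) \<and>
     (\<forall>c. \<forall>x\<in>sl n. \<theta> (c \<cdot>\<^sub>m x) = c \<cdot>\<^sub>m \<theta> x) \<and>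
     (\<forall>x\<in>sl n. \<forall>y\<in>sl n. \<theta> (lie_bracket x y) = lie_bracket (\<theta> x) (\<theta> y)) \<and>
     (\<forall>x\<in>sl n. \<theta> (\<theta> x) = x) \<and>
     (\<exists>x\<in>sl n. \<theta> x \<noteq> x)"

definition kk :: "nat \<Rightarrow> ('k::comm_ring_1 mat \<Rightarrow> 'k mat) \<Rightarrow> 'k mat set" where
  "kk n \<theta> = {x \<in> sl n. \<theta> x = x}"

definition pp :: "nat \<Rightarrow> ('k::comm_ring_1 mat \<Rightarrow> 'k mat) \<Rightarrow> 'k mat set" where
  "pp n \<theta> = {x \<in> sl n. \<theta> x = - x}"

definition bilinear_form :: "nat \<Rightarrow> ('k::comm_ring_1 vec \<Rightarrow> 'k vec \<Rightarrow> 'k) \<Rightarrow> bool" where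
  "bilinear_form n \<Phi> \<longleftrightarrow>
     (\<forall>u\<in>carrier_vec n. \<forall>v\<in>carrier_vec n. \<forall>w\<in>carrier_vec n.
        \<Phi> (u + v) w = \<Phi> u w + \<Phi> v w \<and> \<Phi> u (v + w) = \<Phi> u v + \<Phi> u w) \<and>
     (\<forall>c. \<forall>u\<in>carrier_vec n. \<forall>v\<in>carrier_vec n.
        \<Phi> (c \<cdot>\<^sub>v u) v = c * \<Phi> u v \<and> \<Phi> u (c \<cdot>\<^sub>v v) = c * \<Phi> u v)"

text \<open>
  One-sided nondegeneracy suffices: it is used only for symmetric and alternating forms.
\<close>

definition nondegenerate_form :: "nat \<Rightarrow> ('k::comm_ring_1 vec \<Rightarrow> 'k vec \<Rightarrow> 'k) \<Rightarrow> bool" where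
  "nondegenerate_form n \<Phi> \<longleftrightarrow>
     (\<forall>u\<in>carrier_vec n. (\<forall>v\<in>carrier_vec n. \<Phi> u v = 0) \<longrightarrow> u = 0\<^sub>v n)"

definition symmetric_form :: "nat \<Rightarrow> ('k::comm_ring_1 vec \<Rightarrow> 'k vec \<Rightarrow> 'k) \<Rightarrow> bool" where
  "symmetric_form n \<Phi> \<longleftrightarrow> (\<forall>u\<in>carrier_vec n. \<forall>v\<in>carrier_vec n. \<Phi> u v = \<Phi> v u)"

definition alternating_form :: "nat \<Rightarrow> ('k::comm_ring_1 vec \<Rightarrow> 'k vec \<Rightarrow> 'k) \<Rightarrow> bool" where
  "alternating_form n \<Phi> \<longleftrightarrow> (\<forall>u\<in>carrier_vec n. \<Phi> u u = 0)"

definition eigenspaces_from_form ::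
    "nat \<Rightarrow> ('k::comm_ring_1 mat \<Rightarrow> 'k mat) \<Rightarrow> ('k vec \<Rightarrow> 'k vec \<Rightarrow> 'k) \<Rightarrow> bool" where
  "eigenspaces_from_form n \<theta> \<Phi> \<longleftrightarrow>
     kk n \<theta> = {x \<in> sl n. \<forall>u\<in>carrier_vec n. \<forall>v\<in>carrier_vec n.
       \<Phi> (x *\<^sub>v u) v + \<Phi> u (x *\<^sub>v v) = 0} \<and>
     pp n \<theta> = {x \<in> sl n. \<forall>u\<in>carrier_vec n. \<forall>v\<in>carrier_vec n.
       \<Phi> (x *\<^sub>v u) v = \<Phi> u (x *\<^sub>v v)}"

definition type_AI :: "nat \<Rightarrow> ('k::comm_ring_1 mat \<Rightarrow> 'k mat) \<Rightarrow> bool" where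
  "type_AI n \<theta> \<longleftrightarrow> (\<exists>\<Phi>. bilinear_form n \<Phi> \<and> nondegenerate_form n \<Phi> \<and>
     symmetric_form n \<Phi> \<and> eigenspaces_from_form n \<theta> \<Phi>)"

definition type_AII :: "nat \<Rightarrow> ('k::comm_ring_1 mat \<Rightarrow> 'k mat) \<Rightarrow> bool" where
  "type_AII n \<theta> \<longleftrightarrow> (\<exists>\<Phi>. bilinear_form n \<Phi> \<and> nondegenerate_form n \<Phi> \<and>
     alternating_form n \<Phi> \<and> eigenspaces_from_form n \<theta> \<Phi>)"

section \<open>The group \<open>K\<close>\<close>

definition SL_group :: "nat \<Rightarrow> 'k::comm_ring_1 mat monoid" where
  "SL_group n = \<lparr>carrier = {g \<in> carrier_mat n n. det g = 1}, mult = (*), one = 1\<^sub>m n\<rparr>"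

text \<open>\<open>SL(V)\<close> is closed in \<open>End(V)\<close>, so closedness in either is the same.\<close>

definition connected_algebraic_subgroup :: "nat \<Rightarrow> 'k::idom mat set \<Rightarrow> bool" where
  "connected_algebraic_subgroup n K \<longleftrightarrow> subgroup K (SL_group n) \<and>
     closedin (mat_zariski n) K \<and> connectedin (mat_zariski n) K"

text \<open>
  The Lie algebra of a closed subgroup is its tangent space at the identity: the matrices \<open>x\<close>
  such that every polynomial function \<open>f\<close> vanishing on the group has derivative zero at the
  identity in direction \<open>x\<close>. This derivative is the linear coefficient of the polynomial
  \<open>f (1 + t x)\<close> in \<open>t\<close>, which exists by the lemma below and is unique over an infinite field.
\<close>

definition lie_algebra_of :: "nat \<Rightarrow> 'k::idom mat set \<Rightarrow> 'k mat set" where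
  "lie_algebra_of n G = {x \<in> carrier_mat n n.
     \<forall>f \<in> polynomial_functions (mat_coordinates n). (\<forall>g\<in>G. f g = 0) \<longrightarrow>
       (\<forall>q. (\<forall>t. f (1\<^sub>m n + t \<cdot>\<^sub>m x) = poly q t) \<longrightarrow> coeff q 1 = 0)}"

lemma polynomial_function_along_line:
  fixes x :: "'k::idom mat"
  assumes "f \<in> polynomial_functions (mat_coordinates n)" and "x \<in> carrier_mat n n"
  shows "\<exists>q. \<forall>t. f (1\<^sub>m n + t \<cdot>\<^sub>m x) = poly q t"
  using assms(1)
proof induction
  case (const c)
  show ?case by (rule exI[of _ "[:c:]"]) simp
next
  case (coordinate f)
  then obtain i j where "f = (\<lambda>A. A $$ (i, j))" "i < n" "j < n"
    by (auto simp: mat_coordinates_def)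
  with assms(2) show ?case
    by (intro exI[of _ "[:1\<^sub>m n $$ (i, j), x $$ (i, j):]"]) auto
next
  case (add f g)
  then show ?case by (metis poly_add)
next
  case (mult f g)
  then show ?case by (metis poly_mult)
qed

section \<open>Nilpotent elements and commuting varieties\<close>

definition nilpotent_mat :: "'k::semiring_1 mat \<Rightarrow> bool" where
  "nilpotent_mat x \<longleftrightarrow> (\<exists>m. x ^\<^sub>m m = 0\<^sub>m (dim_row x) (dim_row x))"

definition nilpotents :: "nat \<Rightarrow> ('k::comm_ring_1 mat \<Rightarrow> 'k mat) \<Rightarrow> 'k mat set" where
  "nilpotents n \<theta> = {x \<in> pp n \<theta>. nilpotent_mat x}"

definition pp_centralizer ::
    "nat \<Rightarrow> ('k::comm_ring_1 mat \<Rightarrow> 'k mat) \<Rightarrow> 'k mat \<Rightarrow> 'k mat set" where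
  "pp_centralizer n \<theta> e = {y \<in> pp n \<theta>. lie_bracket e y = 0\<^sub>m n n}"

definition nil_commuting_variety ::
    "nat \<Rightarrow> ('k::comm_ring_1 mat \<Rightarrow> 'k mat) \<Rightarrow> ('k mat \<times> 'k mat) set" where
  "nil_commuting_variety n \<theta> =
     {(x, y). x \<in> nilpotents n \<theta> \<and> y \<in> nilpotents n \<theta> \<and> lie_bracket x y = 0\<^sub>m n n}"

definition conj_act :: "nat \<Rightarrow> 'k::comm_ring_1 mat \<Rightarrow> 'k mat \<Rightarrow> 'k mat" where
  "conj_act n g x = g * x * (inv\<^bsub>SL_group n\<^esub> g)"

definition C_variety ::
    "nat \<Rightarrow> ('k::idom mat \<Rightarrow> 'k mat) \<Rightarrow> 'k mat set \<Rightarrow> 'k mat \<Rightarrow> ('k mat \<times> 'k mat) set" where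
  "C_variety n \<theta> K e = Abstract_Topology.closure_of (mat_pair_zariski n)
     {(conj_act n g e, conj_act n g y) | g y. g \<in> K \<and> y \<in> nilpotents n \<theta> \<inter> pp_centralizer n \<theta> e}"

definition normal_sl2_triple ::
    "nat \<Rightarrow> ('k::comm_ring_1 mat \<Rightarrow> 'k mat) \<Rightarrow> 'k mat \<Rightarrow> 'k mat \<Rightarrow> 'k mat \<Rightarrow> bool" where
  "normal_sl2_triple n \<theta> e h f \<longleftrightarrow>
     e \<in> pp n \<theta> \<and> f \<in> pp n \<theta> \<and> h \<in> kk n \<theta> \<and>
     lie_bracket h e = 2 \<cdot>\<^sub>m e \<and> lie_bracket h f = (- 2) \<cdot>\<^sub>m f \<and> lie_bracket e f = h"

definition pp_zero ::
    "nat \<Rightarrow> ('k::comm_ring_1 mat \<Rightarrow> 'k mat) \<Rightarrow> 'k mat \<Rightarrow> 'k mat \<Rightarrow> 'k mat set" where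
  "pp_zero n \<theta> e h = {y \<in> pp_centralizer n \<theta> e. lie_bracket h y = 0\<^sub>m n n}"

text \<open>
  All normal triples containing \<open>e\<close> are conjugate under the centralizer of \<open>e\<close> in \<open>K\<close>, so the
  choice of triple is immaterial.
\<close>

definition almost_pp_distinguished ::
    "nat \<Rightarrow> ('k::comm_ring_1 mat \<Rightarrow> 'k mat) \<Rightarrow> 'k mat \<Rightarrow> bool" where
  "almost_pp_distinguished n \<theta> e \<longleftrightarrow> (\<exists>h f. normal_sl2_triple n \<theta> e h f \<and>
     (\<forall>y \<in> pp_zero n \<theta> e h. nilpotent_mat y \<longrightarrow> y = 0\<^sub>m n n))"

text \<open>The order in which the rows are listed plays no role.\<close>

definition young_diagram_rows :: "'k::semiring_1 mat \<Rightarrow> nat list \<Rightarrow> bool" where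
  "young_diagram_rows e ls \<longleftrightarrow> (\<exists>n_as. jordan_nf e n_as \<and> ls = map fst n_as)"

end

theory Submission
  imports Defs "Jordan_Normal_Form.DL_Rank"
begin

text \<open>
  The nilpotent commuting variety is stable under the shears \<open>(x, y) \<mapsto> (x + t y, y)\<close>, and the union
  of all shears of an irreducible set is irreducible. Hence a component \<open>\<CC>(e)\<close> is stable under
  shears, so it contains \<open>(e + y, y)\<close> for every nilpotent \<open>y \<in> \<pp>\<^sup>e\<close>. On the other hand, the
  first coordinate of a point of \<open>\<CC>(e)\<close> has rank at most \<open>rank e\<close>.

  It remains to find such a \<open>y\<close> with \<open>rank (e + y) > rank e\<close>. The model is two adjacent Jordan
  blocks: if \<open>J\<close> is a regular nilpotent on a space of dimension \<open>2a + 1\<close>, then \<open>J\<^sup>2\<close> has Jordan blocks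
  of sizes \<open>a + 1\<close> and \<open>a\<close>, commutes with \<open>J\<close>, and \<open>J\<^sup>2 + J\<close> has bigger rank than \<open>J\<^sup>2\<close>. Let
  \<open>v, v'\<close> and \<open>w, w'\<close> be killed by \<open>e\<^sup>a\<^sup>+\<^sup>1\<close> and \<open>e\<^sup>a\<close>, respectively, with \<open>\<Phi>(v', e\<^sup>a v) \<noteq> 0\<close> and
  \<open>\<Phi>(w', e\<^sup>a\<^sup>-\<^sup>1 w) \<noteq> 0\<close>, where \<open>v = v'\<close> and \<open>w = w'\<close> in type AI. The self-adjoint map
  \<open>Z u = \<Phi>(v', u) w + \<epsilon> \<Phi>(v, u) w' + \<Phi>(w', u) v + \<epsilon> \<Phi>(w, u) v'\<close>, with \<open>\<epsilon>\<close> the sign of the form,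
  yields \<open>y = \<Sum> e\<^sup>j Z e\<^sup>i\<close>, the sum being over \<open>i + j = a\<close>. Up to higher powers of \<open>e\<close>,
  \<open>y\<close> interlaces the chains of \<open>v\<close> and \<open>w\<close> in the same way as \<open>J\<close>.
\<close>

section \<open>Rank\<close>

definition outer :: "'k::comm_ring_1 vec \<Rightarrow> 'k vec \<Rightarrow> 'k mat" where
  "outer w p = mat (dim_vec w) (dim_vec p) (\<lambda>(i, j). w $ i * p $ j)"

lemma outer_carrier [simp, intro]:
  "w \<in> carrier_vec m \<Longrightarrow> p \<in> carrier_vec n \<Longrightarrow> outer w p \<in> carrier_mat m n"
  unfolding outer_def by auto

lemma outer_mult_vec:
  assumes "w \<in> carrier_vec m" "p \<in> carrier_vec n" "u \<in> carrier_vec n"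
  shows "outer w p *\<^sub>v u = (p \<bullet> u) \<cdot>\<^sub>v w"
  using assms by (intro eq_vecI)
    (auto simp: outer_def scalar_prod_def sum_distrib_right sum_distrib_left intro!: sum.cong)

text \<open>Preimages under \<open>B\<close> of the columns of \<open>A\<close>, chosen one for each
  unit vector, serve as the columns of \<open>M\<close>.\<close>

lemma range_subset_imp_factor:
  fixes A B :: "'k::comm_ring_1 mat"
  assumes "A \<in> carrier_mat n m" "B \<in> carrier_mat n k"
    and "\<And>u. u \<in> carrier_vec m \<Longrightarrow> \<exists>x\<in>carrier_vec k. A *\<^sub>v u = B *\<^sub>v x"
  obtains M where "M \<in> carrier_mat k m" "A = B * M"
proof -
  have "\<forall>j. \<exists>x. j < m \<longrightarrow> x \<in> carrier_vec k \<and> A *\<^sub>v unit_vec m j = B *\<^sub>v x"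
    using assms(3)[of "unit_vec m _"] by (metis unit_vec_carrier)
  then obtain x where x: "\<And>j. j < m \<Longrightarrow> x j \<in> carrier_vec k \<and> A *\<^sub>v unit_vec m j = B *\<^sub>v x j"
    by metis
  define M where "M = mat k m (\<lambda>(i, j). x j $ i)"
  have M: "M \<in> carrier_mat k m"
    by (simp add: M_def)
  have "col M j = x j" if "j < m" for j
    using x[OF that] that by (auto simp: M_def)
  moreover have "A *\<^sub>v unit_vec m j = col A j" if "j < m" for j
    using assms(1) that by (intro eq_vecI) auto
  ultimately have "col A j = col (B * M) j" if "j < m" for j
    using x[OF that] that assms(1,2) M by (metis carrier_matD(2) col_mult2)
  then have "A = B * M"
    using assms(1,2) M by (intro mat_col_eqI) (auto simp del: col_mult2)
  with M that show thesis by blast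
qed

section \<open>Rank as the dimension of the column space\<close>

context vec_space begin

text \<open>A maximal independent set of columns of \<open>A\<close> stays independent in the column
  space of \<open>B\<close>. In the strict case \<open>B x\<close> lies outside its span, so
  adjoining it yields one more independent vector.\<close>

lemma
  assumes A: "A \<in> carrier_mat n m" and B: "B \<in> carrier_mat n k"
    and sub: "\<And>u. u \<in> carrier_vec m \<Longrightarrow> \<exists>x\<in>carrier_vec k. A *\<^sub>v u = B *\<^sub>v x"
  shows rank_mono: "rank A \<le> rank B"
    and rank_strict_mono: "x \<in> carrier_vec k \<Longrightarrow> (\<And>u. u \<in> carrier_vec m \<Longrightarrow> A *\<^sub>v u \<noteq> B *\<^sub>v x) \<Longrightarrow> rank A < rank B"
proof -
  have cA: "set (cols A) \<subseteq> carrier_vec n" and cB: "set (cols B) \<subseteq> carrier_vec n"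
    using A B cols_dim by blast+
  have spA: "span (set (cols A)) = {y. \<exists>x\<in>carrier_vec m. A *\<^sub>v x = y}"
    using col_space_eq[OF A] A unfolding col_space_def by auto
  have spB: "span (set (cols B)) = {y. \<exists>x\<in>carrier_vec k. B *\<^sub>v x = y}"
    using col_space_eq[OF B] B unfolding col_space_def by auto
  have AB: "span (set (cols A)) \<subseteq> span (set (cols B))"
    unfolding spA spB using sub by fastforce
  have "\<exists>U. finite U \<and> maximal U (\<lambda>T. T \<subseteq> set (cols A) \<and> lin_indpt T) \<and> {} \<subseteq> U"
    by (rule maximal_exists_superset[of "set (cols A)"]) (auto simp: lin_dep_def)
  then obtain U where finU: "finite U"
    and U: "maximal U (\<lambda>T. T \<subseteq> set (cols A) \<and> lin_indpt T)" by blast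
  have Uc: "U \<subseteq> set (cols A)" and Ui: "lin_indpt U"
    using U unfolding maximal_def by auto
  have rA: "rank A = card U" by (rule rank_card_indpt[OF A U])
  let ?W = "span (set (cols B))"
  have subW: "submodule class_ring ?W V" using span_is_submodule[OF cB] .
  have vsW: "vectorspace class_ring (span_vs (set (cols B)))"
    using span_is_subspace[OF cB] subspace_is_vs by blast
  have fdW: "vectorspace.fin_dim class_ring (span_vs (set (cols B)))"
    using fin_dim_span_cols[OF B] .
  have le: "card T \<le> rank B" if "T \<subseteq> ?W" "lin_indpt T" for T
  proof -
    have "LinearCombinations.module.lin_indpt class_ring (span_vs (set (cols B))) T"
      using span_li_not_depend(2)[OF that(1) subW] that(2) by simp
    then show ?thesis
      unfolding rank_def
      using vectorspace.li_le_dim(2)[OF vsW fdW] that(1) by simp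
  qed
  have UW: "U \<subseteq> ?W"
    using Uc AB in_own_span[OF cA] by blast
  show "rank A \<le> rank B"
    using le[OF UW Ui] rA by simp
  assume x: "x \<in> carrier_vec k" and nx: "\<And>u. u \<in> carrier_vec m \<Longrightarrow> A *\<^sub>v u \<noteq> B *\<^sub>v x"
  let ?w = "B *\<^sub>v x"
  have w: "?w \<in> ?W" "?w \<in> carrier_vec n" "?w \<notin> span (set (cols A))"
    using x nx B unfolding spA spB by auto
  have nU: "?w \<notin> span U"
    using w(3) span_is_monotone[OF Uc] by blast
  have Un: "U \<subseteq> carrier_vec n" using Uc cA by blast
  have "lin_indpt (insert ?w U)"
    using lin_dep_iff_in_span[OF _ Ui w(2)] nU Un span_mem[OF Un] by auto
  then have "card (insert ?w U) \<le> rank B"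
    using w(1) UW by (intro le) auto
  moreover have "?w \<notin> U" using nU span_mem[OF Un] by blast
  ultimately show "rank A < rank B"
    using rA finU by simp
qed

text \<open>The columns of \<open>P\<close> are a basis of the column space picked among the columns
  of \<open>A\<close>; the columns of \<open>Q\<close> are coordinates with respect to it.\<close>

lemma rank_factorization:
  assumes A: "A \<in> carrier_mat n m"
  obtains P Q where "P \<in> carrier_mat n (rank A)" "Q \<in> carrier_mat (rank A) m" "A = P * Q"
proof -
  have cA: "set (cols A) \<subseteq> carrier_vec n"
    using A cols_dim by blast
  have "\<exists>U. finite U \<and> maximal U (\<lambda>T. T \<subseteq> set (cols A) \<and> lin_indpt T) \<and> {} \<subseteq> U"
    by (rule maximal_exists_superset[of "set (cols A)"]) (auto simp: lin_dep_def)
  then obtain U where finU: "finite U"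
    and U: "maximal U (\<lambda>T. T \<subseteq> set (cols A) \<and> lin_indpt T)" by blast
  have Uc: "U \<subseteq> set (cols A)" and Ui: "lin_indpt U"
    using U unfolding maximal_def by auto
  have Un: "U \<subseteq> carrier_vec n" using Uc cA by blast
  have rA: "rank A = card U" by (rule rank_card_indpt[OF A U])
  obtain us where us: "set us = U" "distinct us"
    using finite_distinct_list[OF finU] by blast
  then have len: "length us = rank A"
    using rA distinct_card by fastforce
  define P where "P = mat_of_cols n us"
  have P: "P \<in> carrier_mat n (rank A)"
    by (simp add: P_def len[symmetric])
  have colsP: "cols P = us"
    using us Un by (simp add: P_def)
  have spP: "span U = {y. \<exists>x\<in>carrier_vec (rank A). P *\<^sub>v x = y}"
    using col_space_eq[OF P] P unfolding col_space_def colsP us(1) by auto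
  have mem: "s \<in> span U" if s: "s \<in> set (cols A)" for s
  proof (rule ccontr)
    assume ns: "s \<notin> span U"
    then have "s \<notin> U" using span_mem[OF Un] by blast
    moreover have "lin_indpt (insert s U)"
      using lin_dep_iff_in_span[OF Un Ui _ \<open>s \<notin> U\<close>] s cA ns by auto
    ultimately show False
      using U s Uc unfolding maximal_def by blast
  qed
  have "span (set (cols A)) \<subseteq> span U"
    using mem span_is_submodule[OF Un] by (intro span_is_subset) auto
  moreover have "span (set (cols A)) = {y. \<exists>x\<in>carrier_vec m. A *\<^sub>v x = y}"
    using col_space_eq[OF A] A unfolding col_space_def by auto
  ultimately have sub: "{y. \<exists>x\<in>carrier_vec m. A *\<^sub>v x = y} \<subseteq> {y. \<exists>x\<in>carrier_vec (rank A). P *\<^sub>v x = y}"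
    using spP by simp
  have "\<exists>x\<in>carrier_vec (rank A). A *\<^sub>v u = P *\<^sub>v x" if "u \<in> carrier_vec m" for u
  proof -
    have "A *\<^sub>v u \<in> {y. \<exists>x\<in>carrier_vec m. A *\<^sub>v x = y}"
      using that by blast
    then obtain x where "x \<in> carrier_vec (rank A)" "P *\<^sub>v x = A *\<^sub>v u"
      using sub by blast
    then show ?thesis by (intro bexI[of _ x]) simp_all
  qed
  from range_subset_imp_factor[OF A P this] show thesis
    using P that by blast
qed

text \<open>Factoring \<open>A = P Q\<close> through a space of dimension \<open>rank A\<close>
  makes \<open>g A h\<close> factor through the same space, and \<open>g P\<close> has only
  \<open>rank A\<close> columns. It is applied to conjugates of \<open>e\<close>.\<close>

lemma rank_mult_le:
  assumes A: "A \<in> carrier_mat n n" and g: "g \<in> carrier_mat n n" and h: "h \<in> carrier_mat n n"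
  shows "rank (g * A * h) \<le> rank A"
proof -
  obtain P Q where PQ: "P \<in> carrier_mat n (rank A)" "Q \<in> carrier_mat (rank A) n" "A = P * Q"
    using rank_factorization[OF A] by blast
  have "g * A * h = (g * P) * (Q * h)"
  proof -
    have "g * (P * Q) * h = (g * P) * Q * h"
      using assoc_mult_mat[OF g PQ(1,2)] by simp
    also have "\<dots> = (g * P) * (Q * h)"
      using PQ(1,2) g h by (intro assoc_mult_mat) auto
    finally show ?thesis using PQ(3) by simp
  qed
  moreover have "rank ((g * P) * (Q * h)) \<le> rank (g * P)"
  proof (rule rank_mono)
    fix u :: "'a vec" assume u: "u \<in> carrier_vec n"
    show "\<exists>x\<in>carrier_vec (rank A). (g * P) * (Q * h) *\<^sub>v u = (g * P) *\<^sub>v x"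
      using PQ(1,2) g h u by (intro bexI[of _ "(Q * h) *\<^sub>v u"] assoc_mult_mat_vec) auto
  qed (use PQ(1,2) g h in auto)
  moreover have "rank (g * P) \<le> rank A"
    using PQ(1) g by (intro rank_le_nc) auto
  ultimately show ?thesis by simp
qed

text \<open>A singular matrix gains rank when a rank one matrix is added that maps some kernel vector
  outside of the range.\<close>

lemma exists_invertible_completion:
  assumes "A \<in> carrier_mat n n"
  shows "\<exists>C\<in>carrier_mat n n. det (A + C) \<noteq> 0 \<and> rank A + rank C \<le> n"
  using assms
proof (induction "n - rank A" arbitrary: A rule: less_induct)
  case less
  note A = less.prems
  show ?case
  proof (cases "det A = 0")
    case False
    then have "rank A = n" using det_rank_iff[OF A] by simp
    with False A show ?thesis
      by (intro bexI[of _ "0\<^sub>m n n"]) (auto simp: rank_0I)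
  next
    case True
    then have rA: "rank A < n" using det_zero_low_rank[OF A] by simp
    obtain u where u: "u \<in> carrier_vec n" "u \<noteq> 0\<^sub>v n" "A *\<^sub>v u = 0\<^sub>v n"
      using det_0_iff_vec_prod_zero[OF A] True by blast
    have "\<exists>i<n. u $ i \<noteq> 0"
      using u(1,2) by (metis carrier_vecD eq_vecI index_zero_vec)
    then obtain i where i: "i < n" "u $ i \<noteq> 0" by blast
    \<comment> \<open>A coordinate functional, scaled to take the value 1 at the kernel vector
      \<open>u\<close>.\<close>
    define f where "f = (1 / u $ i) \<cdot>\<^sub>v unit_vec n i"
    have f: "f \<in> carrier_vec n" by (simp add: f_def)
    have fu: "f \<bullet> u = 1" using i u(1) by (simp add: f_def)
    \<comment> \<open>If \<open>A\<close> were surjective it would have a right inverse, against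
      \<open>det A = 0\<close>.\<close>
    have "\<exists>w\<in>carrier_vec n. \<forall>x\<in>carrier_vec n. A *\<^sub>v x \<noteq> w"
    proof (rule ccontr)
      assume "\<not> ?thesis"
      then have "\<And>w. w \<in> carrier_vec n \<Longrightarrow> \<exists>x\<in>carrier_vec n. 1\<^sub>m n *\<^sub>v w = A *\<^sub>v x"
        by (metis one_mult_mat_vec)
      then have "\<exists>M\<in>carrier_mat n n. 1\<^sub>m n = A * M"
        using range_subset_imp_factor[OF one_carrier_mat A] by metis
      then show False
        using det_mult[OF A] True by (metis det_one mult_zero_left zero_neq_one)
    qed
    then obtain w where w: "w \<in> carrier_vec n" "\<And>x. x \<in> carrier_vec n \<Longrightarrow> A *\<^sub>v x \<noteq> w" by blast
    define R where "R = outer w f"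
    have R: "R \<in> carrier_mat n n" using w f by (simp add: R_def)
    have Rv: "R *\<^sub>v x = (f \<bullet> x) \<cdot>\<^sub>v w" if "x \<in> carrier_vec n" for x
      using outer_mult_vec[OF w(1) f that] by (simp add: R_def)
    have AR: "(A + R) *\<^sub>v x = A *\<^sub>v x + (f \<bullet> x) \<cdot>\<^sub>v w" if "x \<in> carrier_vec n" for x
      using add_mult_distrib_mat_vec[OF A R that] Rv[OF that] by simp
    have ARu: "(A + R) *\<^sub>v u = w"
      using AR[OF u(1)] u(3) fu w(1) by simp
    have "rank A < rank (A + R)"
    proof (rule rank_strict_mono[OF A _ _ u(1)])
      show "A + R \<in> carrier_mat n n" using A R by simp
      show "A *\<^sub>v x \<noteq> (A + R) *\<^sub>v u" if "x \<in> carrier_vec n" for x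
        using w(2)[OF that] ARu by simp
      show "\<exists>y\<in>carrier_vec n. A *\<^sub>v x = (A + R) *\<^sub>v y" if x: "x \<in> carrier_vec n" for x
      proof
        \<comment> \<open>Subtracting a multiple of the kernel vector leaves the value of
          \<open>A\<close> unchanged and makes \<open>f\<close> vanish, so \<open>A\<close> and
          \<open>A + R\<close> agree there. Thus the range of \<open>A\<close> is kept, while
          \<open>w\<close> is new.\<close>
        let ?y = "x - (f \<bullet> x) \<cdot>\<^sub>v u"
        show y: "?y \<in> carrier_vec n" using x u by simp
        have "A *\<^sub>v ?y = A *\<^sub>v x"
          using A x u by (simp add: mult_minus_distrib_mat_vec[OF A] mult_mat_vec[OF A])
        moreover have "f \<bullet> ?y = 0"
          using f x u fu by (simp add: scalar_prod_minus_distrib[OF f])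
        ultimately show "A *\<^sub>v x = (A + R) *\<^sub>v ?y"
          using AR[OF y] w(1) A x by simp
      qed
    qed
    moreover have ARc: "A + R \<in> carrier_mat n n" using A R by simp
    ultimately obtain C where C: "C \<in> carrier_mat n n" "det (A + R + C) \<noteq> 0" "rank (A + R) + rank C \<le> n"
      using less.hyps[of "A + R"] rA by (meson diff_less_mono2)
    have "rank R \<le> 1"
      by (rule rank_le_1_product_entries[OF R, of "\<lambda>i. w $ i" "\<lambda>j. f $ j"])
        (use R in \<open>auto simp: R_def outer_def\<close>)
    \<comment> \<open>The extra 1 is paid for by the rank gained in passing from \<open>A\<close> to
      \<open>A + R\<close>.\<close>
    then have "rank (R + C) \<le> 1 + rank C"
      using rank_subadditive[OF R C(1)] by simp
    then show ?thesis
      using C R A \<open>rank A < rank (A + R)\<close>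
      by (intro bexI[of _ "R + C"]) (auto simp: assoc_add_mat[of _ n n])
  qed
qed

end

section \<open>Jordan chains\<close>

lemma mult_mat_zero_vec:
  "A \<in> carrier_mat m n \<Longrightarrow> A *\<^sub>v 0\<^sub>v n = 0\<^sub>v m"
  by (intro eq_vecI) auto

text \<open>Isolates one block inside a block diagonal matrix: the rows and columns through block
  \<open>i\<close>, which starts at offset \<open>s\<close>, vanish outside it. The induction peels
  off the first block and shifts the offset.\<close>

lemma diag_block_mat_index:
  assumes "\<forall>A\<in>set As. square_mat A" and "i < length As"
  defines "s \<equiv> sum_list (map dim_row (take i As))"
  shows "s + dim_row (As ! i) \<le> sum_list (map dim_row As) \<and>
    (\<forall>j<dim_row (As ! i). \<forall>r<sum_list (map dim_row As).
      diag_block_mat As $$ (r, s + j) =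
        (if s \<le> r \<and> r < s + dim_row (As ! i) then (As ! i) $$ (r - s, j) else 0) \<and>
      diag_block_mat As $$ (s + j, r) =
        (if s \<le> r \<and> r < s + dim_row (As ! i) then (As ! i) $$ (j, r - s) else 0))"
  using assms(1,2) unfolding s_def
proof (induction As arbitrary: i)
  case (Cons A As)
  have sqA: "dim_col A = dim_row A" using Cons.prems(1) by simp
  have sqs: "\<forall>A\<in>set As. square_mat A" using Cons.prems(1) by simp
  have dc: "map dim_col As = map dim_row As"
    using sqs by simp
  note [simp] = sqA dc dim_diag_block_mat Let_def
  show ?case
  proof (cases i)
    case 0
    then show ?thesis by auto
  next
    case (Suc i')
    have i': "i' < length As" using Cons.prems(2) Suc by simp
    define s' where "s' = sum_list (map dim_row (take i' As))"
    note IH = Cons.IH[OF sqs i', folded s'_def]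
    have le: "s' + dim_row (As ! i') \<le> sum_list (map dim_row As)"
      using IH by blast
    have "diag_block_mat (A # As) $$ (r, dim_row A + s' + j) =
        (if dim_row A + s' \<le> r \<and> r < dim_row A + s' + dim_row (As ! i')
         then (As ! i') $$ (r - (dim_row A + s'), j) else 0) \<and>
      diag_block_mat (A # As) $$ (dim_row A + s' + j, r) =
        (if dim_row A + s' \<le> r \<and> r < dim_row A + s' + dim_row (As ! i')
         then (As ! i') $$ (j, r - (dim_row A + s')) else 0)"
      if j: "j < dim_row (As ! i')" and r: "r < dim_row A + sum_list (map dim_row As)" for j r
    proof (cases "r < dim_row A")
      case True
      then show ?thesis using le j by auto
    next
      case False
      then obtain r' where r': "r = dim_row A + r'"
        by (metis add_diff_inverse_nat)
      with r have "r' < sum_list (map dim_row As)" by simp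
      with IH j show ?thesis
        unfolding r' using le by (auto simp: diff_add_inverse add.assoc)
    qed
    with le show ?thesis
      unfolding Suc by (simp add: s'_def[symmetric])
  qed
qed simp

text \<open>In a Jordan basis, \<open>v\<close> is the last basis vector of block \<open>i\<close>
  and \<open>p\<close> the coordinate functional of the first one. The power \<open>b - 1\<close> of
  the block moves the last vector to the first, and the power \<open>b\<close> kills the
  block.\<close>

lemma jordan_nf_chain:
  fixes e :: "'k::field mat"
  assumes e: "e \<in> carrier_mat n n" and nil: "nilpotent_mat e"
    and nf: "jordan_nf e n_as" and i: "i < length n_as"
  defines "b \<equiv> fst (n_as ! i)"
  shows "\<exists>v\<in>carrier_vec n. \<exists>p\<in>carrier_vec n. e ^\<^sub>m b *\<^sub>v v = 0\<^sub>v n \<and>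
    (\<forall>x\<in>carrier_vec n. p \<bullet> (e ^\<^sub>m b *\<^sub>v x) = 0) \<and> p \<bullet> (e ^\<^sub>m (b - 1) *\<^sub>v v) \<noteq> 0"
proof -
  define D where "D = jordan_matrix n_as"
  define a where "a = snd (n_as ! i)"
  obtain P Q where wit: "similar_mat_wit e D P Q"
    using nf unfolding jordan_nf_def similar_mat_def D_def by blast
  note w = similar_mat_witD[OF _ wit, of n]
  have dn: "n = dim_row e" using e by simp
  have D: "D \<in> carrier_mat n n" and P: "P \<in> carrier_mat n n" and Q: "Q \<in> carrier_mat n n"
    and PQ: "P * Q = 1\<^sub>m n" and QP: "Q * P = 1\<^sub>m n"
    using w[OF dn] by auto
  have pow: "e ^\<^sub>m k = P * D ^\<^sub>m k * Q" for k
    by (rule similar_mat_wit_pow_id[OF wit])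
  have Dk: "D ^\<^sub>m k \<in> carrier_mat n n" for k using D by simp
  have sum: "sum_list (map fst n_as) = n"
    using D unfolding D_def by auto
  have b: "0 < b"
    using nf i unfolding jordan_nf_def b_def by (metis gr0I image_eqI nth_mem)
  define s where "s = sum_list (map fst (take i n_as))"
  define As where "As k = map (\<lambda>(m, c). jordan_block m c ^\<^sub>m k) n_as" for k
  have DAs: "D ^\<^sub>m k = diag_block_mat (As k)" for k
    unfolding D_def As_def by (rule jordan_matrix_pow)
  have sq: "\<forall>A\<in>set (As k). square_mat A" for k
    by (auto simp: As_def)
  have dims: "map dim_row (As k) = map fst n_as" for k
    by (auto simp: As_def)
  have len: "length (As k) = length n_as" for k by (simp add: As_def)
  have nth: "As k ! i = jordan_block b a ^\<^sub>m k" for k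
    using i by (simp add: As_def b_def a_def split_beta)
  have off: "sum_list (map dim_row (take i (As k))) = s" for k
    unfolding s_def take_map[symmetric] dims by simp
  note idx = diag_block_mat_index[OF sq, where i = i, unfolded off nth len dims sum jordan_block_pow_dim, folded DAs, OF i]
  have sb: "s + b \<le> n"
    using idx[of 0] by blast
  have colD: "(D ^\<^sub>m k) $$ (r, s + j) =
      (if s \<le> r \<and> r < s + b then (jordan_block b a ^\<^sub>m k) $$ (r - s, j) else 0)"
    and rowD: "(D ^\<^sub>m k) $$ (s + j, r) =
      (if s \<le> r \<and> r < s + b then (jordan_block b a ^\<^sub>m k) $$ (j, r - s) else 0)"
    if "j < b" "r < n" for k j r
    using idx[of k] that by blast+
  have QeP: "Q * e ^\<^sub>m k * P = D ^\<^sub>m k" for k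
  proof -
    have "Q * e ^\<^sub>m k * P = Q * (P * (D ^\<^sub>m k * Q)) * P"
      using pow P Q Dk by (simp add: assoc_mult_mat[of _ n n _ n _ n] mult_carrier_mat[of _ n n _ n])
    also have "\<dots> = (Q * P) * D ^\<^sub>m k * (Q * P)"
      using P Q Dk by (simp add: assoc_mult_mat[of _ n n _ n _ n] mult_carrier_mat[of _ n n _ n])
    finally show ?thesis by (simp add: QP left_mult_one_mat[OF Dk] right_mult_one_mat[OF Dk])
  qed
  \<comment> \<open>The eigenvalue vanishes because \<open>a ^ m\<close> is a diagonal entry of a
    power of \<open>D\<close> that is zero.\<close>
  have "a = 0"
  proof -
    obtain m where "e ^\<^sub>m m = 0\<^sub>m n n"
      using nil e unfolding nilpotent_mat_def by auto
    then have "D ^\<^sub>m m = 0\<^sub>m n n"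
      using QeP[of m] P Q by simp
    moreover have "(D ^\<^sub>m m) $$ (s + 0, s + 0) = a ^ m"
      using colD[OF b, of "s + 0" m] sb b by (simp add: jordan_block_pow)
    ultimately show ?thesis using sb b by simp
  qed
  define v where "v = P *\<^sub>v unit_vec n (s + (b - 1))"
  define p where "p = row Q (s + 0)"
  have v: "v \<in> carrier_vec n" using P by (simp add: v_def)
  have p: "p \<in> carrier_vec n" using Q row_carrier[of Q "s + 0"] by (simp add: p_def)
  have lt: "s + (b - 1) < n" "s + 0 < n" using sb b by auto
  have Qv: "Q *\<^sub>v v = unit_vec n (s + (b - 1))"
    using assoc_mult_mat_vec[OF Q P, of "unit_vec n (s + (b - 1))"] QP by (simp add: v_def)
  have ex: "e ^\<^sub>m k *\<^sub>v x = P *\<^sub>v (D ^\<^sub>m k *\<^sub>v (Q *\<^sub>v x))" if "x \<in> carrier_vec n" for k x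
    unfolding pow using P Q Dk that by (simp add: assoc_mult_mat_vec[of _ n n _ n])
  have pP: "p \<bullet> (P *\<^sub>v x) = x $ (s + 0)" if x: "x \<in> carrier_vec n" for x
  proof -
    have "p \<bullet> (P *\<^sub>v x) = (Q *\<^sub>v (P *\<^sub>v x)) $ (s + 0)"
      using Q lt by (simp add: p_def)
    also have "Q *\<^sub>v (P *\<^sub>v x) = x"
      using assoc_mult_mat_vec[OF Q P x] QP x by simp
    finally show ?thesis .
  qed
  have Dv: "D ^\<^sub>m k *\<^sub>v unit_vec n (s + (b - 1)) = col (D ^\<^sub>m k) (s + (b - 1))" for k
    using Dk[of k] lt by (intro eq_vecI) auto
  have "e ^\<^sub>m b *\<^sub>v v = 0\<^sub>v n"
  proof -
    have "col (D ^\<^sub>m b) (s + (b - 1)) = 0\<^sub>v n"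
      using carrier_matD[OF Dk[of b]] lt colD[of "b - 1" _ b] b \<open>a = 0\<close>
      by (intro eq_vecI) (auto simp: jordan_block_zero_pow index_col)
    then show ?thesis
      using ex[OF v] Qv Dv mult_mat_zero_vec[OF P] by simp
  qed
  moreover have "p \<bullet> (e ^\<^sub>m b *\<^sub>v x) = 0" if x: "x \<in> carrier_vec n" for x
  proof -
    have "row (D ^\<^sub>m b) (s + 0) = 0\<^sub>v n"
      using carrier_matD[OF Dk[of b]] lt rowD[of 0 _ b] b \<open>a = 0\<close>
      by (intro eq_vecI) (auto simp: jordan_block_zero_pow)
    then have "(D ^\<^sub>m b *\<^sub>v (Q *\<^sub>v x)) $ (s + 0) = 0"
      using index_mult_mat_vec[of "s + 0" "D ^\<^sub>m b" "Q *\<^sub>v x"] carrier_matD[OF D] Q x lt by simp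
    then show ?thesis
      using ex[OF x] pP[of "D ^\<^sub>m b *\<^sub>v (Q *\<^sub>v x)"] Dk[of b] Q x by simp
  qed
  moreover have "p \<bullet> (e ^\<^sub>m (b - 1) *\<^sub>v v) \<noteq> 0"
  proof -
    have "p \<bullet> (e ^\<^sub>m (b - 1) *\<^sub>v v) = (D ^\<^sub>m (b - 1)) $$ (s + 0, s + (b - 1))"
      using ex[OF v] Qv Dv[of "b - 1"] pP[of "col (D ^\<^sub>m (b - 1)) (s + (b - 1))"] Dk[of "b - 1"]
        carrier_matD[OF Dk[of "b - 1"]] lt by simp
    also have "\<dots> = 1"
      using colD[of "b - 1" "s + 0" "b - 1"] b sb \<open>a = 0\<close> by (simp add: jordan_block_zero_pow)
    finally show ?thesis by simp
  qed
  ultimately show ?thesis using v p by blast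
qed

section \<open>Shears and the Zariski topology\<close>

lemma polynomial_functions_sum:
  assumes "\<And>i. i \<in> I \<Longrightarrow> f i \<in> polynomial_functions C"
  shows "(\<lambda>p. \<Sum>i\<in>I. f i p) \<in> polynomial_functions C"
  using assms
  by (induction I rule: infinite_finite_induct)
    (auto intro: polynomial_functions.intros)

lemma polynomial_functions_prod:
  assumes "\<And>i. i \<in> I \<Longrightarrow> f i \<in> polynomial_functions C"
  shows "(\<lambda>p. \<Prod>i\<in>I. f i p) \<in> polynomial_functions C"
  using assms
  by (induction I rule: infinite_finite_induct)
    (auto intro: polynomial_functions.intros)

abbreviation pair_coordinates :: "nat \<Rightarrow> ('k::idom mat \<times> 'k mat \<Rightarrow> 'k) set" where
  "pair_coordinates n \<equiv>
     (\<lambda>c p. c (fst p)) ` mat_coordinates n \<union> (\<lambda>c p. c (snd p)) ` mat_coordinates n"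

lemma entry_polynomial:
  assumes "i < n" "j < n"
  shows fst_entry_polynomial: "(\<lambda>p. fst p $$ (i, j)) \<in> polynomial_functions (pair_coordinates n)"
    and snd_entry_polynomial: "(\<lambda>p. snd p $$ (i, j)) \<in> polynomial_functions (pair_coordinates n)"
  using assms by (auto intro!: polynomial_functions.coordinate image_eqI[of _ _ "\<lambda>A. A $$ (i, j)"]
    simp: mat_coordinates_def)

text \<open>The Leibniz formula is a polynomial in the entries of the first coordinate, with the
  entries of \<open>C\<close> as constants.\<close>

lemma closedin_pair_det:
  fixes C :: "'k::idom mat"
  assumes C: "C \<in> carrier_mat n n"
  shows "closedin (mat_pair_zariski n) {p \<in> carrier_mat n n \<times> carrier_mat n n. det (fst p + C) = 0}"
proof -
  define f where "f p = (\<Sum>\<pi>\<in>{\<pi>. \<pi> permutes {0..<n}}.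
    of_int (sign \<pi>) * (\<Prod>i\<in>{0..<n}. fst p $$ (i, \<pi> i) + C $$ (i, \<pi> i)))" for p :: "'k mat \<times> 'k mat"
  have f: "f \<in> polynomial_functions (pair_coordinates n)"
    unfolding f_def
  proof (intro polynomial_functions_sum polynomial_functions.mult polynomial_functions_prod
      polynomial_functions.add polynomial_functions.const fst_entry_polynomial)
    fix \<pi> i assume "\<pi> \<in> {\<pi>. \<pi> permutes {0..<n}}" "i \<in> {0..<n}"
    then show "i < n" "\<pi> i < n"
      using permutes_in_image[of \<pi> "{0..<n}" i] by auto
  qed
  have deteq: "det (fst p + C) = f p" if "p \<in> carrier_mat n n \<times> carrier_mat n n" for p
  proof -
    have c: "fst p + C \<in> carrier_mat n n" using that C by auto
    have ent: "(fst p + C) $$ (i, \<pi> i) = fst p $$ (i, \<pi> i) + C $$ (i, \<pi> i)"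
      if "\<pi> permutes {0..<n}" "i \<in> {0..<n}" for \<pi> i
      using permutes_in_image[OF that(1), of i] that(2) C by simp
    show ?thesis
      unfolding f_def det_def'[OF c] using ent
      by (intro sum.cong prod.cong arg_cong2[of _ _ _ _ "(*)"] refl) auto
  qed
  have "{p \<in> carrier_mat n n \<times> carrier_mat n n. det (fst p + C) = 0} =
      zero_locus (carrier_mat n n \<times> carrier_mat n n) {f}"
    unfolding zero_locus_def
    by (intro Collect_cong conj_cong refl) (simp only: deteq ball_simps HOL.simp_thms)
  with f show ?thesis
    unfolding mat_pair_zariski_def closedin_zariski
    by (intro exI[of _ "{f}"]) simp
qed

text \<open>The same expression is viewed in two ways: for fixed \<open>t\<close> as a function of
  the pair, which gives continuity of the shear, and for a fixed pair as a polynomial in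
  \<open>t\<close>, which allows root counting.\<close>

lemma polynomial_function_shear:
  fixes f :: "'k::idom mat \<times> 'k mat \<Rightarrow> 'k"
  assumes "f \<in> polynomial_functions (pair_coordinates n)"
  shows "\<exists>g\<in>polynomial_functions (pair_coordinates n).
    \<forall>x\<in>carrier_mat n n. \<forall>y\<in>carrier_mat n n. f (x + t \<cdot>\<^sub>m y, y) = g (x, y)"
    and "x \<in> carrier_mat n n \<Longrightarrow> y \<in> carrier_mat n n \<Longrightarrow> \<exists>q. \<forall>t. f (x + t \<cdot>\<^sub>m y, y) = poly q t"
proof -
  show "\<exists>g\<in>polynomial_functions (pair_coordinates n).
    \<forall>x\<in>carrier_mat n n. \<forall>y\<in>carrier_mat n n. f (x + t \<cdot>\<^sub>m y, y) = g (x, y)"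
    using assms
  proof induction
    case (const c)
    show ?case by (rule bexI[OF _ polynomial_functions.const]) auto
  next
    case (coordinate f)
    then obtain i j where ij: "i < n" "j < n"
      and "f = (\<lambda>p. fst p $$ (i, j)) \<or> f = (\<lambda>p. snd p $$ (i, j))"
      by (auto simp: mat_coordinates_def)
    then consider "f = (\<lambda>p. fst p $$ (i, j))" | "f = (\<lambda>p. snd p $$ (i, j))" by blast
    then show ?case
    proof cases
      case 1
      have "(\<lambda>p. fst p $$ (i, j) + t * snd p $$ (i, j)) \<in> polynomial_functions (pair_coordinates n)"
        by (intro polynomial_functions.add polynomial_functions.mult entry_polynomial polynomial_functions.const ij)
      then show ?thesis
        by (rule bexI[rotated]) (use 1 ij in auto)
    next
      case 2
      show ?thesis
        by (rule bexI[OF _ snd_entry_polynomial[OF ij]]) (use 2 in auto)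
    qed
  next
    case (add f1 f2)
    then obtain g1 g2 where "g1 \<in> polynomial_functions (pair_coordinates n)" "g2 \<in> polynomial_functions (pair_coordinates n)"
      "\<forall>x\<in>carrier_mat n n. \<forall>y\<in>carrier_mat n n. f1 (x + t \<cdot>\<^sub>m y, y) = g1 (x, y) \<and> f2 (x + t \<cdot>\<^sub>m y, y) = g2 (x, y)"
      by blast
    then show ?case
      by (intro bexI[OF _ polynomial_functions.add[of g1 _ g2]]) auto
  next
    case (mult f1 f2)
    then obtain g1 g2 where "g1 \<in> polynomial_functions (pair_coordinates n)" "g2 \<in> polynomial_functions (pair_coordinates n)"
      "\<forall>x\<in>carrier_mat n n. \<forall>y\<in>carrier_mat n n. f1 (x + t \<cdot>\<^sub>m y, y) = g1 (x, y) \<and> f2 (x + t \<cdot>\<^sub>m y, y) = g2 (x, y)"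
      by blast
    then show ?case
      by (intro bexI[OF _ polynomial_functions.mult[of g1 _ g2]]) auto
  qed
  assume xy: "x \<in> carrier_mat n n" "y \<in> carrier_mat n n"
  show "\<exists>q. \<forall>t. f (x + t \<cdot>\<^sub>m y, y) = poly q t"
    using assms
  proof induction
    case (const c)
    show ?case by (rule exI[of _ "[:c:]"]) simp
  next
    case (coordinate f)
    then obtain i j where ij: "i < n" "j < n"
      and "f = (\<lambda>p. fst p $$ (i, j)) \<or> f = (\<lambda>p. snd p $$ (i, j))"
      by (auto simp: mat_coordinates_def)
    then consider "f = (\<lambda>p. fst p $$ (i, j))" | "f = (\<lambda>p. snd p $$ (i, j))" by blast
    then show ?case
    proof cases
      case 1
      then show ?thesis
        using xy ij by (intro exI[of _ "[:x $$ (i, j), y $$ (i, j):]"]) auto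
    next
      case 2
      then show ?thesis
        by (intro exI[of _ "[:y $$ (i, j):]"]) auto
    qed
  next
    case (add f g)
    then show ?case by (metis poly_add)
  next
    case (mult f g)
    then show ?case by (metis poly_mult)
  qed
qed

text \<open>A shear with fixed parameter pulls polynomial functions back to polynomial functions, so
  it is continuous.\<close>

lemma closedin_shear_preimage:
  fixes A :: "('k::idom mat \<times> 'k mat) set"
  assumes "closedin (mat_pair_zariski n) A"
  shows "closedin (mat_pair_zariski n)
    {(x, y). x \<in> carrier_mat n n \<and> y \<in> carrier_mat n n \<and> (x + t \<cdot>\<^sub>m y, y) \<in> A}"
proof -
  obtain F where F: "F \<subseteq> polynomial_functions (pair_coordinates n)"
    and A: "A = zero_locus (carrier_mat n n \<times> carrier_mat n n) F"
    using assms unfolding mat_pair_zariski_def closedin_zariski by blast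
  have "\<forall>f\<in>F. \<exists>g. g \<in> polynomial_functions (pair_coordinates n) \<and>
    (\<forall>x\<in>carrier_mat n n. \<forall>y\<in>carrier_mat n n. f (x + t \<cdot>\<^sub>m y, y) = g (x, y))"
    using polynomial_function_shear(1) F by blast
  then obtain G where G: "\<And>f. f \<in> F \<Longrightarrow> G f \<in> polynomial_functions (pair_coordinates n)"
    "\<And>f x y. f \<in> F \<Longrightarrow> x \<in> carrier_mat n n \<Longrightarrow> y \<in> carrier_mat n n \<Longrightarrow> f (x + t \<cdot>\<^sub>m y, y) = G f (x, y)"
    by metis
  show ?thesis
    unfolding mat_pair_zariski_def closedin_zariski A
    by (intro exI[of _ "G ` F"]) (use G in \<open>auto simp: zero_locus_def\<close>)
qed

text \<open>By irreducibility each shear lies in one of two covering closed sets, hence for one of the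
  two this happens for infinitely many parameters, and then for all of them.\<close>

lemma irreducible_in_shear:
  fixes S :: "('k::{idom, ring_char_0} mat \<times> 'k mat) set"
  assumes S: "irreducible_in (mat_pair_zariski n) S"
  shows "irreducible_in (mat_pair_zariski n) {(x + t \<cdot>\<^sub>m y, y) | t x y. (x, y) \<in> S}"
proof -
  let ?T = "mat_pair_zariski n :: ('k mat \<times> 'k mat) topology"
  have top: "topspace ?T = carrier_mat n n \<times> carrier_mat n n"
    by (simp add: mat_pair_zariski_def)
  have Sc: "x \<in> carrier_mat n n" "y \<in> carrier_mat n n" if "(x, y) \<in> S" for x y
    using S that unfolding irreducible_in_def top by auto
  have half: "(\<forall>t x y. (x, y) \<in> S \<longrightarrow> (x + t \<cdot>\<^sub>m y, y) \<in> A)"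
    if A: "closedin ?T A" and inf: "infinite {t. \<forall>x y. (x, y) \<in> S \<longrightarrow> (x + t \<cdot>\<^sub>m y, y) \<in> A}" for A
  proof (intro allI impI)
    fix t x y assume xy: "(x, y) \<in> S"
    obtain F where F: "F \<subseteq> polynomial_functions (pair_coordinates n)"
      and AF: "A = zero_locus (carrier_mat n n \<times> carrier_mat n n) F"
      using A unfolding mat_pair_zariski_def closedin_zariski by blast
    have "f (x + t \<cdot>\<^sub>m y, y) = 0" if f: "f \<in> F" for f
    proof -
      obtain q where q: "\<And>t. f (x + t \<cdot>\<^sub>m y, y) = poly q t"
        using polynomial_function_shear(2)[of f n x y] F f Sc[OF xy] by blast
      \<comment> \<open>Every parameter in the infinite set is a root of \<open>q\<close>, which
        must therefore be the zero polynomial.\<close>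
      have "{t. \<forall>x y. (x, y) \<in> S \<longrightarrow> (x + t \<cdot>\<^sub>m y, y) \<in> A} \<subseteq> {t. poly q t = 0}"
        using xy f q[symmetric] unfolding AF zero_locus_def by auto
      then have "infinite {t. poly q t = 0}"
        using inf finite_subset by blast
      then have "q = 0" using poly_roots_finite by blast
      then show ?thesis using q by simp
    qed
    then show "(x + t \<cdot>\<^sub>m y, y) \<in> A"
      unfolding AF zero_locus_def using Sc[OF xy] by auto
  qed
  show ?thesis
    unfolding irreducible_in_def
  proof (intro conjI allI impI)
    show "{(x + t \<cdot>\<^sub>m y, y) | t x y. (x, y) \<in> S} \<subseteq> topspace ?T"
      using Sc by (auto simp: top)
    show "{(x + t \<cdot>\<^sub>m y, y) | t x y. (x, y) \<in> S} \<noteq> {}"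
      using S unfolding irreducible_in_def by auto
    fix A B
    assume AB: "closedin ?T A \<and> closedin ?T B \<and> {(x + t \<cdot>\<^sub>m y, y) | t x y. (x, y) \<in> S} \<subseteq> A \<union> B"
    let ?P = "\<lambda>A t. {(x, y). x \<in> carrier_mat n n \<and> y \<in> carrier_mat n n \<and> (x + t \<cdot>\<^sub>m y, y) \<in> A}"
    let ?I = "\<lambda>A. {t. \<forall>x y. (x, y) \<in> S \<longrightarrow> (x + t \<cdot>\<^sub>m y, y) \<in> A}"
    have "t \<in> ?I A \<or> t \<in> ?I B" for t
    proof -
      have "S \<subseteq> ?P A t \<union> ?P B t"
      proof
        fix p assume "p \<in> S"
        then obtain x y where p: "p = (x, y)" "(x, y) \<in> S" by (cases p) auto
        then have "(x + t \<cdot>\<^sub>m y, y) \<in> A \<union> B" using AB by blast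
        then show "p \<in> ?P A t \<union> ?P B t" using p Sc by auto
      qed
      moreover have "closedin ?T (?P A t)" "closedin ?T (?P B t)"
        using AB closedin_shear_preimage by blast+
      ultimately have "S \<subseteq> ?P A t \<or> S \<subseteq> ?P B t"
        using S unfolding irreducible_in_def by meson
      then show ?thesis by auto
    qed
    then have "?I A \<union> ?I B = UNIV" by blast
    then have "infinite (?I A \<union> ?I B)"
      using infinite_UNIV_char_0 by (simp only:)
    then consider "infinite (?I A)" | "infinite (?I B)"
      by (meson finite_UnI)
    then show "{(x + t \<cdot>\<^sub>m y, y) | t x y. (x, y) \<in> S} \<subseteq> A \<or> {(x + t \<cdot>\<^sub>m y, y) | t x y. (x, y) \<in> S} \<subseteq> B"
    proof cases
      case 1
      with AB half[of A] show ?thesis by blast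
    next
      case 2
      with AB half[of B] show ?thesis by blast
    qed
  qed
qed

section \<open>Commuting nilpotents of large rank\<close>

lemma mat_pow_add:
  assumes "e \<in> carrier_mat n n"
  shows "e ^\<^sub>m (i + j) = e ^\<^sub>m i * e ^\<^sub>m j"
proof (induction j)
  case 0
  show ?case
    using right_mult_one_mat[OF pow_carrier_mat[OF assms]] assms by simp
next
  case (Suc j)
  then show ?case
    using assms by (simp add: assoc_mult_mat[of _ n n _ n _ n])
qed

lemma mat_pow_mult_vec_add:
  assumes "e \<in> carrier_mat n n" "u \<in> carrier_vec n"
  shows "e ^\<^sub>m i *\<^sub>v (e ^\<^sub>m j *\<^sub>v u) = e ^\<^sub>m (i + j) *\<^sub>v u"
  using assms by (simp add: mat_pow_add assoc_mult_mat_vec[of _ n n _ n])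

lemma mat_add_right_cancel:
  fixes A B C :: "'k::cancel_semigroup_add mat"
  assumes "A \<in> carrier_mat n m" "B \<in> carrier_mat n m" "C \<in> carrier_mat n m" "A + C = B + C"
  shows "A = B"
proof (rule eq_matI)
  fix i j assume "i < dim_row B" "j < dim_col B"
  then show "A $$ (i, j) = B $$ (i, j)"
    using assms(1-3) arg_cong[OF assms(4), of "\<lambda>M. M $$ (i, j)"] by simp
qed (use assms in auto)

lemma mat_trace_mult_comm:
  fixes A :: "'k::comm_semiring_0 mat"
  assumes "A \<in> carrier_mat n m" "B \<in> carrier_mat m n"
  shows "mat_trace (A * B) = mat_trace (B * A)"
proof -
  have "mat_trace (A * B) = (\<Sum>i<n. \<Sum>j<m. A $$ (i, j) * B $$ (j, i))"
    using assms by (auto simp: mat_trace_def scalar_prod_def atLeast0LessThan intro!: sum.cong)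
  also have "\<dots> = (\<Sum>j<m. \<Sum>i<n. B $$ (j, i) * A $$ (i, j))"
    by (subst sum.swap) (simp add: mult.commute)
  also have "\<dots> = mat_trace (B * A)"
    using assms by (auto simp: mat_trace_def scalar_prod_def atLeast0LessThan intro!: sum.cong)
  finally show ?thesis .
qed

lemma mat_trace_add:
  "A \<in> carrier_mat n n \<Longrightarrow> B \<in> carrier_mat n n \<Longrightarrow> mat_trace (A + B) = mat_trace A + mat_trace B"
  by (simp add: mat_trace_def sum.distrib)

text \<open>This is the sum of \<open>e\<^sup>j Z e\<^sup>i\<close> over all \<open>i + j = k - 1\<close>. Its commutator with \<open>e\<close> telescopes
  to \<open>e\<^sup>k Z - Z e\<^sup>k\<close>.\<close>

primrec power_derivation :: "'k::semiring_1 mat \<Rightarrow> 'k mat \<Rightarrow> nat \<Rightarrow> 'k mat" where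
  "power_derivation e Z 0 = 0\<^sub>m (dim_row e) (dim_row e)"
| "power_derivation e Z (Suc k) = e * power_derivation e Z k + Z * e ^\<^sub>m k"

section \<open>Commutation and trace of the sum of the products \<open>e^j Z e^i\<close>\<close>

locale mat_pair =
  fixes n :: nat and e Z :: "'k::field mat"
  assumes e [simp, intro]: "e \<in> carrier_mat n n"
    and Z [simp, intro]: "Z \<in> carrier_mat n n"
begin

lemma dims [simp]: "dim_row e = n" "dim_col e = n" "dim_row Z = n" "dim_col Z = n"
  using e Z by (simp_all only: carrier_mat_def mem_Collect_eq)

abbreviation "y \<equiv> power_derivation e Z"

lemma pow_carrier [simp, intro]: "e ^\<^sub>m k \<in> carrier_mat n n"
  by simp

lemma y_carrier [simp, intro]: "y k \<in> carrier_mat n n"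
  by (induction k) (auto intro: add_carrier_mat mult_carrier_mat[of _ n n _ n])

lemma mult_vec_carrier [simp, intro]:
  "M \<in> carrier_mat n n \<Longrightarrow> u \<in> carrier_vec n \<Longrightarrow> M *\<^sub>v u \<in> carrier_vec n"
  by simp

lemma pow_Suc_left: "e ^\<^sub>m Suc k = e * e ^\<^sub>m k"
  using mat_pow_add[OF e, of 1 k] by simp

text \<open>The definition splits off the summand without a left factor \<open>e\<close>; this
  version splits off the one without a right factor \<open>e\<close>.\<close>

lemma y_Suc_right: "y (Suc k) = y k * e + e ^\<^sub>m k * Z"
proof (induction k)
  case 0
  show ?case
    using left_mult_zero_mat[OF e, of n] right_mult_zero_mat[OF e, of n] left_mult_one_mat[OF Z] right_mult_one_mat[OF Z]
    by simp
next
  case (Suc k)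
  have "y (Suc (Suc k)) = e * (y k * e + e ^\<^sub>m k * Z) + Z * e ^\<^sub>m Suc k"
    using Suc by simp
  also have "\<dots> = (e * y k * e + e ^\<^sub>m Suc k * Z) + Z * e ^\<^sub>m k * e"
    by (simp add: mult_add_distrib_mat[of _ n n _ n] assoc_mult_mat[of _ n n _ n _ n]
        mult_carrier_mat[of _ n n _ n] pow_Suc_left del: pow_mat.simps(2))
      (simp add: assoc_mult_mat[of _ n n _ n _ n, symmetric] pow_Suc_left[symmetric] mult_carrier_mat[of _ n n _ n])
  also have "\<dots> = (e * y k + Z * e ^\<^sub>m k) * e + e ^\<^sub>m Suc k * Z"
  proof -
    have c: "e * y k * e \<in> carrier_mat n n" "e ^\<^sub>m Suc k * Z \<in> carrier_mat n n" "Z * e ^\<^sub>m k * e \<in> carrier_mat n n"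
      "e * y k \<in> carrier_mat n n" "Z * e ^\<^sub>m k \<in> carrier_mat n n"
      by (auto intro!: mult_carrier_mat[of _ n n _ n])
    show ?thesis
      unfolding add_mult_distrib_mat[OF c(4,5) e] assoc_add_mat[OF c(1,2,3)]
        comm_add_mat[OF c(2,3)] assoc_add_mat[OF c(1,3,2)] ..
  qed
  finally show ?case by simp
qed

text \<open>The left and right recursions for \<open>y (Suc k)\<close> differ from each other only
  by the order of the factors in \<open>e y\<close> and in \<open>Z e^k\<close>; the latter terms
  cancel by assumption.\<close>

lemma y_commute:
  assumes "e ^\<^sub>m k * Z = Z * e ^\<^sub>m k"
  shows "e * y k = y k * e"
proof -
  have "e * y k + Z * e ^\<^sub>m k = y k * e + Z * e ^\<^sub>m k"
    using y_Suc_right[of k] assms by simp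
  then show ?thesis
    by (rule mat_add_right_cancel[rotated 3]) (auto intro!: mult_carrier_mat[of _ n n _ n])
qed

lemma y_Suc_mult_vec:
  assumes "u \<in> carrier_vec n"
  shows "y (Suc k) *\<^sub>v u = e *\<^sub>v (y k *\<^sub>v u) + Z *\<^sub>v (e ^\<^sub>m k *\<^sub>v u)"
    and "y (Suc k) *\<^sub>v u = y k *\<^sub>v (e *\<^sub>v u) + e ^\<^sub>m k *\<^sub>v (Z *\<^sub>v u)"
proof -
  have c: "e * y k \<in> carrier_mat n n" "Z * e ^\<^sub>m k \<in> carrier_mat n n"
    "y k * e \<in> carrier_mat n n" "e ^\<^sub>m k * Z \<in> carrier_mat n n"
    by (auto intro!: mult_carrier_mat[of _ n n _ n])
  show "y (Suc k) *\<^sub>v u = e *\<^sub>v (y k *\<^sub>v u) + Z *\<^sub>v (e ^\<^sub>m k *\<^sub>v u)"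
    using add_mult_distrib_mat_vec[OF c(1,2) assms] assms by (simp add: assoc_mult_mat_vec[of _ n n _ n])
  show "y (Suc k) *\<^sub>v u = y k *\<^sub>v (e *\<^sub>v u) + e ^\<^sub>m k *\<^sub>v (Z *\<^sub>v u)"
    unfolding y_Suc_right
    using add_mult_distrib_mat_vec[OF c(3,4) assms] assms by (simp add: assoc_mult_mat_vec[of _ n n _ n])
qed

text \<open>By cyclicity of the trace all \<open>k\<close> summands contribute equally. The exponent
  \<open>m\<close> is general because the induction moves a factor \<open>e\<close> into the power;
  for \<open>k = 0\<close> the truncated subtraction is harmless as the coefficient is 0.\<close>

lemma trace_pow_mult_y: "mat_trace (e ^\<^sub>m m * y k) = of_nat k * mat_trace (Z * e ^\<^sub>m (m + k - 1))"
proof (induction k arbitrary: m)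
  case 0
  show ?case using right_mult_zero_mat[OF pow_carrier] by (simp add: mat_trace_def)
next
  case (Suc k)
  have c: "e ^\<^sub>m m * e * y k \<in> carrier_mat n n" "e ^\<^sub>m m * (Z * e ^\<^sub>m k) \<in> carrier_mat n n"
    "Z * e ^\<^sub>m k \<in> carrier_mat n n" "e * y k \<in> carrier_mat n n"
    by (auto intro!: mult_carrier_mat[of _ n n _ n])
  have "e ^\<^sub>m m * y (Suc k) = e ^\<^sub>m m * e * y k + e ^\<^sub>m m * (Z * e ^\<^sub>m k)"
    using mult_add_distrib_mat[OF pow_carrier c(4,3)] assoc_mult_mat[OF pow_carrier[of m] e y_carrier[of k]]
    by simp
  then have "mat_trace (e ^\<^sub>m m * y (Suc k)) = mat_trace (e ^\<^sub>m Suc m * y k) + mat_trace (e ^\<^sub>m m * (Z * e ^\<^sub>m k))"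
    using mat_trace_add[OF c(1,2)] by simp
  also have "mat_trace (e ^\<^sub>m Suc m * y k) = of_nat k * mat_trace (Z * e ^\<^sub>m (m + k))"
    using Suc.IH[of "Suc m"] by simp
  also have "mat_trace (e ^\<^sub>m m * (Z * e ^\<^sub>m k)) = mat_trace (Z * e ^\<^sub>m k * e ^\<^sub>m m)"
    by (rule mat_trace_mult_comm[OF pow_carrier c(3)])
  also have "Z * e ^\<^sub>m k * e ^\<^sub>m m = Z * e ^\<^sub>m (m + k)"
    using assoc_mult_mat[OF Z pow_carrier pow_carrier, of k m] mat_pow_add[OF e, of k m]
    by (simp add: add.commute)
  finally show ?case by (simp add: distrib_right)
qed

end

lemma zero_mat_mult_vec: "u \<in> carrier_vec n \<Longrightarrow> 0\<^sub>m m n *\<^sub>v u = 0\<^sub>v m"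
  by (intro eq_vecI) auto

lemma mat_eqI_mult_vec:
  fixes A B :: "'k::comm_ring_1 mat"
  assumes "A \<in> carrier_mat m n" "B \<in> carrier_mat m n"
    and "\<And>u. u \<in> carrier_vec n \<Longrightarrow> A *\<^sub>v u = B *\<^sub>v u"
  shows "A = B"
proof (rule mat_col_eqI)
  fix j assume "j < dim_col B"
  then have j: "j < n" using assms(2) by simp
  have "M *\<^sub>v unit_vec n j = col M j" if "M \<in> carrier_mat m n" for M :: "'k mat"
    using that j by (intro eq_vecI) auto
  then show "col A j = col B j"
    using assms j by (metis unit_vec_carrier)
qed (use assms in auto)

text \<open>
  \<open>A\<close> and \<open>B\<close> stand for the spaces spanned by the generators of Jordan chains of lengths \<open>a\<close> and
  \<open>a + 1\<close>, and \<open>Z\<close> is a sum of rank one maps that pair the two kinds of chains with each other.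
\<close>

locale adapted_mat_pair = mat_pair +
  fixes A B :: "'a vec set" and a :: nat
  assumes a: "0 < a"
    and nilpotent_e: "\<exists>m. e ^\<^sub>m m = 0\<^sub>m n n"
    and commutes: "e ^\<^sub>m Suc a * Z = Z * e ^\<^sub>m Suc a"
    and A_carrier: "A \<subseteq> carrier_vec n" and B_carrier: "B \<subseteq> carrier_vec n"
    and Z_range: "u \<in> carrier_vec n \<Longrightarrow> \<exists>x\<in>A. \<exists>x'\<in>B. Z *\<^sub>v u = x + x'"
    and Z_pow_range: "u \<in> carrier_vec n \<Longrightarrow> Z *\<^sub>v (e ^\<^sub>m a *\<^sub>v u) \<in> A"
    and B_attained: "x' \<in> B \<Longrightarrow> \<exists>x\<in>A. \<exists>x''\<in>A. Z *\<^sub>v (e ^\<^sub>m (a - 1) *\<^sub>v x) = x'' + x'"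
    and A_attained: "x \<in> A \<Longrightarrow> \<exists>x'\<in>B. Z *\<^sub>v (e ^\<^sub>m a *\<^sub>v x') = x"
    and A_killed: "x \<in> A \<Longrightarrow> e ^\<^sub>m a *\<^sub>v x = 0\<^sub>v n"
    and A_not_range: "\<exists>x\<in>A. \<forall>u\<in>carrier_vec n. e *\<^sub>v u \<noteq> x"
begin

text \<open>With index \<open>Suc a\<close> the sum runs over all \<open>i + j = a\<close>.\<close>

definition Y where "Y = y (Suc a)"
definition s where "s = e + Y"

lemma Y_carrier [simp, intro]: "Y \<in> carrier_mat n n"
  unfolding Y_def by (rule y_carrier)

lemma s_carrier [simp, intro]: "s \<in> carrier_mat n n"
  unfolding s_def by simp

lemma Y_commute: "e * Y = Y * e"
  unfolding Y_def by (rule y_commute[OF commutes])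

lemma Y_e: "u \<in> carrier_vec n \<Longrightarrow> Y *\<^sub>v (e *\<^sub>v u) = e *\<^sub>v (Y *\<^sub>v u)"
  using assoc_mult_mat_vec[OF e Y_carrier, of u] assoc_mult_mat_vec[OF Y_carrier e, of u] Y_commute by simp

lemma s_mult_vec: "u \<in> carrier_vec n \<Longrightarrow> s *\<^sub>v u = e *\<^sub>v u + Y *\<^sub>v u"
  unfolding s_def by (rule add_mult_distrib_mat_vec[OF e Y_carrier])

lemma s_e: "u \<in> carrier_vec n \<Longrightarrow> s *\<^sub>v (e *\<^sub>v u) = e *\<^sub>v (s *\<^sub>v u)"
  by (simp add: s_mult_vec Y_e mult_add_distrib_mat_vec[of _ n n])

lemma pow_vec_add: "u \<in> carrier_vec n \<Longrightarrow> e ^\<^sub>m i *\<^sub>v (e ^\<^sub>m j *\<^sub>v u) = e ^\<^sub>m (i + j) *\<^sub>v u"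
  by (rule mat_pow_mult_vec_add[OF e])

lemma pow_vec_e: "u \<in> carrier_vec n \<Longrightarrow> e ^\<^sub>m i *\<^sub>v (e *\<^sub>v u) = e ^\<^sub>m Suc i *\<^sub>v u"
  using pow_vec_add[of u i 1] by simp

lemma s_pow: "u \<in> carrier_vec n \<Longrightarrow> s *\<^sub>v (e ^\<^sub>m i *\<^sub>v u) = e ^\<^sub>m i *\<^sub>v (s *\<^sub>v u)"
proof (induction i arbitrary: u)
  case (Suc i)
  have "s *\<^sub>v (e ^\<^sub>m Suc i *\<^sub>v u) = s *\<^sub>v (e ^\<^sub>m i *\<^sub>v (e *\<^sub>v u))"
    using Suc.prems by (simp only: pow_vec_e)
  also have "\<dots> = e ^\<^sub>m i *\<^sub>v (e *\<^sub>v (s *\<^sub>v u))"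
    using Suc.prems Suc.IH[of "e *\<^sub>v u"] by (simp add: s_e)
  also have "\<dots> = e ^\<^sub>m Suc i *\<^sub>v (s *\<^sub>v u)"
    using Suc.prems by (intro pow_vec_e) auto
  finally show ?case .
qed simp

lemma pow_add_vec: "u \<in> carrier_vec n \<Longrightarrow> v \<in> carrier_vec n \<Longrightarrow>
    e ^\<^sub>m i *\<^sub>v (u + v) = e ^\<^sub>m i *\<^sub>v u + e ^\<^sub>m i *\<^sub>v v"
  by (rule mult_add_distrib_mat_vec[OF pow_carrier])

lemma carriers: "x \<in> A \<Longrightarrow> x \<in> carrier_vec n" "x \<in> B \<Longrightarrow> x \<in> carrier_vec n"
  using A_carrier B_carrier by auto

text \<open>Modulo the range of \<open>e\<close>, only the summand \<open>Z e^a\<close> of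
  \<open>Y\<close> survives, and its values lie in \<open>A\<close>.\<close>

lemma Y_mult_vec:
  "u \<in> carrier_vec n \<Longrightarrow> Y *\<^sub>v u = e *\<^sub>v (y a *\<^sub>v u) + Z *\<^sub>v (e ^\<^sub>m a *\<^sub>v u)"
  unfolding Y_def by (rule y_Suc_mult_vec)

lemma Y_mult_A: "x \<in> A \<Longrightarrow> Y *\<^sub>v x = e *\<^sub>v (y a *\<^sub>v x)"
  using Y_mult_vec[of x] carriers(1)[of x] A_killed[of x] mult_mat_zero_vec[OF Z] by simp

section \<open>The range of \<open>e + Y\<close>\<close>

definition W where "W = {s *\<^sub>v u | u. u \<in> carrier_vec n}"

lemma W_carrier: "x \<in> W \<Longrightarrow> x \<in> carrier_vec n"
  unfolding W_def by auto

lemma W_add: "x \<in> W \<Longrightarrow> x' \<in> W \<Longrightarrow> x + x' \<in> W"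
  unfolding W_def using mult_add_distrib_mat_vec[OF s_carrier] by (smt (verit) add_carrier_vec mem_Collect_eq)

lemma W_diff: "x \<in> W \<Longrightarrow> x + x' \<in> W \<Longrightarrow> x' \<in> carrier_vec n \<Longrightarrow> x' \<in> W"
proof -
  assume x: "x \<in> W" and xx: "x + x' \<in> W" and x': "x' \<in> carrier_vec n"
  obtain u v where uv: "u \<in> carrier_vec n" "v \<in> carrier_vec n" "x = s *\<^sub>v u" "x + x' = s *\<^sub>v v"
    using x xx unfolding W_def by auto
  have "s *\<^sub>v (v - u) = (x + x') - x"
    using mult_minus_distrib_mat_vec[OF s_carrier uv(2,1)] uv(3,4) by simp
  also have "\<dots> = x'"
    using x' W_carrier[OF x] by (intro eq_vecI) auto
  finally show "x' \<in> W"
    unfolding W_def using uv(1,2) by (intro CollectI exI[of _ "v - u"]) simp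
qed

text \<open>Since \<open>W\<close> is \<open>e\<close>-stable and \<open>e + Y\<close> vanishes modulo \<open>W\<close>, a descending induction on \<open>k\<close>
  shows that \<open>W\<close> contains \<open>e\<^sup>k A\<close> and \<open>e\<^sup>k\<^sup>+\<^sup>1 B\<close>: modulo higher powers of \<open>e\<close>, the map \<open>Y\<close> sends
  \<open>B\<close> onto \<open>A\<close> and \<open>A\<close> onto \<open>e B\<close>.\<close>

lemma pow_y_in_W:
  assumes "\<And>i x. m \<le> i \<Longrightarrow> x \<in> A \<union> B \<Longrightarrow> e ^\<^sub>m i *\<^sub>v x \<in> W"
    and u: "u \<in> carrier_vec n"
  shows "e ^\<^sub>m m *\<^sub>v (y k *\<^sub>v u) \<in> W"
  using assms(1)
proof (induction k arbitrary: m)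
  case 0
  have "e ^\<^sub>m m *\<^sub>v (y 0 *\<^sub>v u) = s *\<^sub>v 0\<^sub>v n"
    using mult_mat_zero_vec[OF s_carrier] mult_mat_zero_vec[OF pow_carrier]
      zero_mat_mult_vec[OF u, of n] by simp
  then show ?case unfolding W_def by (intro CollectI exI[of _ "0\<^sub>v n"] conjI zero_carrier_vec)
next
  case (Suc k)
  \<comment> \<open>The factor \<open>e\<close> in front of \<open>y k\<close> is absorbed into the
    power, so the induction hypothesis is used with \<open>Suc m\<close> in place of
    \<open>m\<close>.\<close>
  have 1: "e ^\<^sub>m Suc m *\<^sub>v (y k *\<^sub>v u) \<in> W"
    by (rule Suc.IH, rule Suc.prems) simp_all
  obtain x x' where x: "x \<in> A" "x' \<in> B" "Z *\<^sub>v (e ^\<^sub>m k *\<^sub>v u) = x + x'"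
    using Z_range[of "e ^\<^sub>m k *\<^sub>v u"] u by blast
  note c = carriers(1)[OF x(1)] carriers(2)[OF x(2)]
  have "e ^\<^sub>m m *\<^sub>v x \<in> W" "e ^\<^sub>m m *\<^sub>v x' \<in> W"
    using Suc.prems[OF order_refl] x(1,2) by blast+
  then have 2: "e ^\<^sub>m m *\<^sub>v (x + x') \<in> W"
    unfolding pow_add_vec[OF c] by (rule W_add)
  have "e ^\<^sub>m m *\<^sub>v (y (Suc k) *\<^sub>v u) = e ^\<^sub>m Suc m *\<^sub>v (y k *\<^sub>v u) + e ^\<^sub>m m *\<^sub>v (x + x')"
    unfolding y_Suc_mult_vec(1)[OF u] x(3)
    using pow_vec_e[of "y k *\<^sub>v u" m] pow_add_vec[of "e *\<^sub>v (y k *\<^sub>v u)" "x + x'" m] u c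
    by (simp del: pow_mat.simps)
  then show ?case using W_add[OF 1 2] by (simp only:)
qed

text \<open>This is the \<open>e\<close>-stability of \<open>W\<close>: \<open>s\<close> commutes
  with the powers of \<open>e\<close>.\<close>

lemma pow_s_in_W: "u \<in> carrier_vec n \<Longrightarrow> e ^\<^sub>m i *\<^sub>v (s *\<^sub>v u) \<in> W"
  unfolding W_def using s_pow[of u i] by (metis (mono_tags, lifting) CollectI mult_vec_carrier pow_carrier)

text \<open>Expanding \<open>e^k (s x)\<close> for a suitable generator \<open>x\<close> gives an
  element of \<open>W\<close> in which all terms but the wanted one are already known to lie in
  \<open>W\<close>. The case of \<open>B\<close> comes first, with \<open>x\<close> in
  \<open>A\<close>; the case of \<open>A\<close> then uses it, with a generator in
  \<open>B\<close>.\<close>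

lemma descent_step:
  assumes IH: "\<And>i x. Suc k \<le> i \<Longrightarrow> x \<in> A \<Longrightarrow> e ^\<^sub>m i *\<^sub>v x \<in> W"
    "\<And>i x. Suc k \<le> i \<Longrightarrow> x \<in> B \<Longrightarrow> e ^\<^sub>m Suc i *\<^sub>v x \<in> W"
  shows "x' \<in> B \<Longrightarrow> e ^\<^sub>m Suc k *\<^sub>v x' \<in> W" and "x \<in> A \<Longrightarrow> e ^\<^sub>m k *\<^sub>v x \<in> W"
proof -
  obtain a' where a': "a = Suc a'" using a by (cases a) auto
  \<comment> \<open>From exponent \<open>k + 2\<close> on, both kinds of generators are covered; for
    \<open>B\<close> the hypothesis already carries one extra factor \<open>e\<close>, hence the
    index \<open>i - 1\<close>.\<close>
  have AB2: "e ^\<^sub>m i *\<^sub>v x \<in> W" if "Suc (Suc k) \<le> i" "x \<in> A \<union> B" for i x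
    using that IH(1)[of i x] IH(2)[of "i - 1" x] by (cases i) auto
  show *: "e ^\<^sub>m Suc k *\<^sub>v x' \<in> W" if x': "x' \<in> B" for x'
  proof -
    obtain x x'' where x: "x \<in> A" "x'' \<in> A" and Zx: "Z *\<^sub>v (e ^\<^sub>m a' *\<^sub>v x) = x'' + x'"
      using B_attained[OF x'] a' by auto
    note c = carriers(1)[OF x(1)] carriers(1)[OF x(2)] carriers(2)[OF x']
    let ?r = "e ^\<^sub>m Suc (Suc k) *\<^sub>v (y a' *\<^sub>v x)"
    have "y a *\<^sub>v x = e *\<^sub>v (y a' *\<^sub>v x) + (x'' + x')"
      using y_Suc_mult_vec(1)[OF c(1), of a'] Zx a' by simp
    then have "e ^\<^sub>m Suc k *\<^sub>v (y a *\<^sub>v x) = ?r + (e ^\<^sub>m Suc k *\<^sub>v x'' + e ^\<^sub>m Suc k *\<^sub>v x')"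
      using pow_add_vec[of "e *\<^sub>v (y a' *\<^sub>v x)" "x'' + x'" "Suc k"] pow_add_vec[OF c(2,3), of "Suc k"]
        pow_vec_e[of "y a' *\<^sub>v x" "Suc k"] c by simp
    moreover have "e ^\<^sub>m k *\<^sub>v (s *\<^sub>v x) = e ^\<^sub>m Suc k *\<^sub>v x + e ^\<^sub>m Suc k *\<^sub>v (y a *\<^sub>v x)"
      using pow_add_vec[of "e *\<^sub>v x" "e *\<^sub>v (y a *\<^sub>v x)" k] c pow_vec_e[of x k] pow_vec_e[of "y a *\<^sub>v x" k]
        s_mult_vec[OF c(1)] Y_mult_A[OF x(1)] by simp
    ultimately have eq: "e ^\<^sub>m Suc k *\<^sub>v x + (?r + (e ^\<^sub>m Suc k *\<^sub>v x'' + e ^\<^sub>m Suc k *\<^sub>v x')) \<in> W"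
      using pow_s_in_W[OF c(1), of k] by simp
    have r: "?r \<in> W" using AB2 c(1) by (rule pow_y_in_W)
    have xW: "e ^\<^sub>m Suc k *\<^sub>v x \<in> W" "e ^\<^sub>m Suc k *\<^sub>v x'' \<in> W"
      using IH(1)[OF order_refl] x by blast+
    have "?r + (e ^\<^sub>m Suc k *\<^sub>v x'' + e ^\<^sub>m Suc k *\<^sub>v x') \<in> W"
      by (rule W_diff[OF xW(1) eq]) (intro add_carrier_vec mult_vec_carrier pow_carrier y_carrier c)
    then have "e ^\<^sub>m Suc k *\<^sub>v x'' + e ^\<^sub>m Suc k *\<^sub>v x' \<in> W"
      by (rule W_diff[OF r]) (intro add_carrier_vec mult_vec_carrier pow_carrier c)
    then show ?thesis
      by (rule W_diff[OF xW(2)]) (intro mult_vec_carrier pow_carrier c)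
  qed
  \<comment> \<open>The statement just shown for \<open>B\<close> lowers the common threshold from
    \<open>k + 2\<close> to \<open>k + 1\<close>.\<close>
  have AB1: "e ^\<^sub>m i *\<^sub>v x \<in> W" if "Suc k \<le> i" "x \<in> A \<union> B" for i x
    using that IH(1)[of i x] AB2[of i x] *[of x] by (cases "i = Suc k") auto
  show "e ^\<^sub>m k *\<^sub>v x \<in> W" if x: "x \<in> A"
  proof -
    obtain x' where x': "x' \<in> B" "Z *\<^sub>v (e ^\<^sub>m a *\<^sub>v x') = x"
      using A_attained[OF x] by blast
    note c = carriers(1)[OF x] carriers(2)[OF x'(1)]
    have "e ^\<^sub>m k *\<^sub>v (s *\<^sub>v x') = e ^\<^sub>m Suc k *\<^sub>v x' + (e ^\<^sub>m Suc k *\<^sub>v (y a *\<^sub>v x') + e ^\<^sub>m k *\<^sub>v x)"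
      using pow_add_vec[of "e *\<^sub>v x'" "e *\<^sub>v (y a *\<^sub>v x') + x" k] pow_add_vec[of "e *\<^sub>v (y a *\<^sub>v x')" x k]
        c pow_vec_e[of x' k] pow_vec_e[of "y a *\<^sub>v x'" k]
        s_mult_vec[OF c(2)] Y_mult_vec[OF c(2)] x'(2) by simp
    then have eq: "e ^\<^sub>m Suc k *\<^sub>v x' + (e ^\<^sub>m Suc k *\<^sub>v (y a *\<^sub>v x') + e ^\<^sub>m k *\<^sub>v x) \<in> W"
      using pow_s_in_W[OF c(2), of k] by simp
    have "e ^\<^sub>m Suc k *\<^sub>v (y a *\<^sub>v x') \<in> W"
      using AB1 c(2) by (rule pow_y_in_W)
    moreover have "e ^\<^sub>m Suc k *\<^sub>v (y a *\<^sub>v x') + e ^\<^sub>m k *\<^sub>v x \<in> W"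
      by (rule W_diff[OF *[OF x'(1)] eq]) (intro add_carrier_vec mult_vec_carrier pow_carrier y_carrier c)
    ultimately show ?thesis
      by (rule W_diff) (intro mult_vec_carrier pow_carrier c)
  qed
qed

lemma zero_in_W: "0\<^sub>v n \<in> W"
  unfolding W_def using mult_mat_zero_vec[OF s_carrier] by (metis (mono_tags, lifting) CollectI zero_carrier_vec)

text \<open>The descent starts at an exponent \<open>m\<close> with \<open>e^m = 0\<close>, where
  there is nothing but the zero vector, and goes down to 0.\<close>

lemma AB_in_W: "x \<in> A \<Longrightarrow> e ^\<^sub>m i *\<^sub>v x \<in> W" "x \<in> B \<Longrightarrow> e ^\<^sub>m Suc i *\<^sub>v x \<in> W"
proof -
  obtain m where m: "e ^\<^sub>m m = 0\<^sub>m n n" using nilpotent_e by blast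
  have zero: "e ^\<^sub>m i = 0\<^sub>m n n" if "m \<le> i" for i
    using mat_pow_add[OF e, of m "i - m"] m that left_mult_zero_mat[OF pow_carrier, of n "i - m"] by simp
  have "\<forall>i\<ge>k. (\<forall>x\<in>A. e ^\<^sub>m i *\<^sub>v x \<in> W) \<and> (\<forall>x\<in>B. e ^\<^sub>m Suc i *\<^sub>v x \<in> W)" if "k \<le> m" for k
    using that
  proof (induction k rule: inc_induct)
    case base
    show ?case
    proof (intro allI impI conjI ballI)
      fix i x assume i: "m \<le> i"
      show "e ^\<^sub>m i *\<^sub>v x \<in> W" if "x \<in> A"
        using zero_in_W zero_mat_mult_vec[OF carriers(1)[OF that], of n] zero[OF i] by simp
      show "e ^\<^sub>m Suc i *\<^sub>v x \<in> W" if "x \<in> B"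
        using zero_in_W zero_mat_mult_vec[OF carriers(2)[OF that], of n] zero[of "Suc i"] i by (simp del: pow_mat.simps)
    qed
  next
    case (step k)
    have IH: "e ^\<^sub>m i *\<^sub>v x \<in> W" if "Suc k \<le> i" "x \<in> A" for i x
      using step.IH that by blast
    have IH': "e ^\<^sub>m Suc i *\<^sub>v x \<in> W" if "Suc k \<le> i" "x \<in> B" for i x
      using step.IH that by blast
    show ?case
    proof (intro allI impI conjI ballI)
      fix i x assume i: "k \<le> i"
      show "e ^\<^sub>m i *\<^sub>v x \<in> W" if "x \<in> A"
        using IH[of i x] descent_step(2)[OF IH IH' that] i that by (cases "i = k") auto
      show "e ^\<^sub>m Suc i *\<^sub>v x \<in> W" if "x \<in> B"
        using IH'[of i x] descent_step(1)[OF IH IH' that] i that by (cases "i = k") auto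
    qed
  qed
  from this[of 0] show "x \<in> A \<Longrightarrow> e ^\<^sub>m i *\<^sub>v x \<in> W" "x \<in> B \<Longrightarrow> e ^\<^sub>m Suc i *\<^sub>v x \<in> W"
    by blast+
qed

text \<open>Since \<open>e u = s u - Y u\<close>, it suffices that \<open>Y u\<close> lies in
  \<open>W\<close>; both of its parts in \<open>Y_mult_vec\<close> do.\<close>

lemma range_e_subset: "u \<in> carrier_vec n \<Longrightarrow> e *\<^sub>v u \<in> W"
proof -
  assume u: "u \<in> carrier_vec n"
  have "e ^\<^sub>m i *\<^sub>v x \<in> W" if "Suc 0 \<le> i" "x \<in> A \<union> B" for i x
    using AB_in_W(1)[of x i] AB_in_W(2)[of x "i - 1"] that by (cases i) auto
  then have "e ^\<^sub>m Suc 0 *\<^sub>v (y a *\<^sub>v u) \<in> W"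
    using u by (rule pow_y_in_W)
  then have 1: "e *\<^sub>v (y a *\<^sub>v u) \<in> W" by simp
  have "Z *\<^sub>v (e ^\<^sub>m a *\<^sub>v u) \<in> W"
    using AB_in_W(1)[OF Z_pow_range[OF u], of 0] carriers(1)[OF Z_pow_range[OF u]] by simp
  with 1 have "Y *\<^sub>v u \<in> W"
    using Y_mult_vec[OF u] W_add by simp
  moreover have "s *\<^sub>v u \<in> W"
    unfolding W_def using u by blast
  then have "Y *\<^sub>v u + e *\<^sub>v u \<in> W"
    using s_mult_vec[OF u] u comm_add_vec[of "e *\<^sub>v u" n "Y *\<^sub>v u"] by simp
  ultimately show ?thesis
    using W_diff u by blast
qed

text \<open>The inclusion of ranges is strict: \<open>W\<close> contains all of \<open>A\<close>,
  but some element of \<open>A\<close> is not in the range of \<open>e\<close>.\<close>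

lemma rank_less: "vec_space.rank n e < vec_space.rank n s"
proof -
  interpret V: vec_space "TYPE('a)" n .
  obtain x where x: "x \<in> A" "\<forall>u\<in>carrier_vec n. e *\<^sub>v u \<noteq> x"
    using A_not_range by blast
  have "x \<in> W"
    using AB_in_W(1)[OF x(1), of 0] carriers(1)[OF x(1)] by simp
  then obtain u where u: "u \<in> carrier_vec n" "x = s *\<^sub>v u"
    unfolding W_def by blast
  show ?thesis
  proof (rule V.rank_strict_mono[OF e s_carrier _ u(1)])
    show "\<exists>x\<in>carrier_vec n. e *\<^sub>v u = s *\<^sub>v x" if "u \<in> carrier_vec n" for u
      using range_e_subset[OF that] unfolding W_def by blast
    show "e *\<^sub>v v \<noteq> s *\<^sub>v u" if "v \<in> carrier_vec n" for v
      using x(2) u(2) that by blast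
  qed
qed

text \<open>Modulo the range of \<open>e\<close>, the map \<open>Y\<close> sends everything into
  \<open>A\<close> and kills \<open>A\<close>.\<close>

lemma Y_sq_range:
  assumes u: "u \<in> carrier_vec n"
  shows "\<exists>z\<in>carrier_vec n. Y *\<^sub>v (Y *\<^sub>v u) = e *\<^sub>v z"
proof -
  let ?x = "Z *\<^sub>v (e ^\<^sub>m a *\<^sub>v u)"
  have x: "?x \<in> A" by (rule Z_pow_range[OF u])
  have "Y *\<^sub>v (Y *\<^sub>v u) = Y *\<^sub>v (e *\<^sub>v (y a *\<^sub>v u)) + Y *\<^sub>v ?x"
    unfolding Y_mult_vec[OF u] by (rule mult_add_distrib_mat_vec[OF Y_carrier]) (use u in auto)
  also have "\<dots> = e *\<^sub>v (Y *\<^sub>v (y a *\<^sub>v u)) + e *\<^sub>v (y a *\<^sub>v ?x)"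
    using Y_e[of "y a *\<^sub>v u"] Y_mult_A[OF x] u by simp
  also have "\<dots> = e *\<^sub>v (Y *\<^sub>v (y a *\<^sub>v u) + y a *\<^sub>v ?x)"
    by (rule mult_add_distrib_mat_vec[OF e, symmetric]) (use u in auto)
  finally show ?thesis
    using u by (intro bexI[of _ "Y *\<^sub>v (y a *\<^sub>v u) + y a *\<^sub>v ?x"]) auto
qed

text \<open>As \<open>Y\<close> commutes with \<open>e\<close>, each pair of factors
  \<open>Y\<close> yields one factor \<open>e\<close>. Nilpotency of \<open>Y\<close> follows from
  that of \<open>e\<close>.\<close>

lemma Y_pow_range: "u \<in> carrier_vec n \<Longrightarrow> \<exists>z\<in>carrier_vec n. Y ^\<^sub>m (2 * k) *\<^sub>v u = e ^\<^sub>m k *\<^sub>v z"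
proof (induction k arbitrary: u)
  case 0
  then show ?case using carrier_matD[OF Y_carrier] by auto
next
  case (Suc k)
  then obtain z where z: "z \<in> carrier_vec n" "Y *\<^sub>v (Y *\<^sub>v u) = e *\<^sub>v z"
    using Y_sq_range by blast
  have Yk: "Y ^\<^sub>m (2 * k) \<in> carrier_mat n n" by (rule pow_carrier_mat[OF Y_carrier])
  have comm: "Y ^\<^sub>m j *\<^sub>v (e *\<^sub>v z) = e *\<^sub>v (Y ^\<^sub>m j *\<^sub>v z)" if "z \<in> carrier_vec n" for j z
    using that
  proof (induction j arbitrary: z)
    case (Suc j)
    have "Y ^\<^sub>m j \<in> carrier_mat n n" by (rule pow_carrier_mat[OF Y_carrier])
    with Suc show ?case
      by (simp add: assoc_mult_mat_vec[of _ n n _ n] Y_e)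
  qed (use carrier_matD[OF Y_carrier] in simp)
  have "Y ^\<^sub>m (2 * Suc k) *\<^sub>v u = Y ^\<^sub>m (2 * k) *\<^sub>v (Y *\<^sub>v (Y *\<^sub>v u))"
    using Suc.prems Yk by (simp add: assoc_mult_mat_vec[of _ n n _ n] mult_carrier_mat[of _ n n _ n])
  also have "\<dots> = e *\<^sub>v (Y ^\<^sub>m (2 * k) *\<^sub>v z)"
    using z comm by simp
  finally obtain z' where "z' \<in> carrier_vec n" "Y ^\<^sub>m (2 * Suc k) *\<^sub>v u = e *\<^sub>v (e ^\<^sub>m k *\<^sub>v z')"
    using Suc.IH[OF z(1)] by auto
  then show ?case
    using pow_vec_add[of z' 1 k] by auto
qed

lemma nilpotent_Y: "nilpotent_mat Y"
proof -
  obtain m where m: "e ^\<^sub>m m = 0\<^sub>m n n" using nilpotent_e by blast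
  have "Y ^\<^sub>m (2 * m) = 0\<^sub>m n n"
  proof (rule mat_eqI_mult_vec)
    show "Y ^\<^sub>m (2 * m) *\<^sub>v u = 0\<^sub>m n n *\<^sub>v u" if "u \<in> carrier_vec n" for u
      using Y_pow_range[OF that, of m] m that by auto
  qed (use pow_carrier_mat[OF Y_carrier] in auto)
  then show ?thesis
    unfolding nilpotent_mat_def using carrier_matD(1)[OF Y_carrier] by auto
qed

lemma mat_trace_Y: "mat_trace Y = of_nat (Suc a) * mat_trace (Z * e ^\<^sub>m a)"
  using trace_pow_mult_y[of 0 "Suc a"] left_mult_one_mat[OF y_carrier, of "Suc a"]
  unfolding Y_def by simp

end

section \<open>Self-adjoint nilpotents\<close>

lemma smult_zero_vec: "c \<cdot>\<^sub>v 0\<^sub>v n = (0\<^sub>v n :: 'k::mult_zero vec)"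
  by (intro eq_vecI) auto

lemma linear_functional_as_scalar_prod:
  fixes f :: "'k::comm_ring_1 vec \<Rightarrow> 'k"
  assumes add: "\<And>u v. u \<in> carrier_vec n \<Longrightarrow> v \<in> carrier_vec n \<Longrightarrow> f (u + v) = f u + f v"
    and smult: "\<And>c u. u \<in> carrier_vec n \<Longrightarrow> f (c \<cdot>\<^sub>v u) = c * f u"
    and v: "v \<in> carrier_vec n"
  shows "f v = vec n (\<lambda>i. f (unit_vec n i)) \<bullet> v"
proof -
  \<comment> \<open>The truncations of \<open>v\<close> to its first \<open>k\<close> coordinates,
    which add one basis vector at a time.\<close>
  let ?t = "\<lambda>k. vec n (\<lambda>i. if i < k then v $ i else 0)"
  have "f (?t k) = (\<Sum>i<k. f (unit_vec n i) * v $ i)" if "k \<le> n" for k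
    using that
  proof (induction k)
    case 0
    have "?t 0 = 0 \<cdot>\<^sub>v v" using v by (intro eq_vecI) auto
    then show ?case using smult[OF v, of 0] by simp
  next
    case (Suc k)
    have "?t (Suc k) = ?t k + v $ k \<cdot>\<^sub>v unit_vec n k"
      using Suc.prems by (intro eq_vecI) (auto simp: less_Suc_eq)
    then show ?case
      using Suc add[of "?t k" "v $ k \<cdot>\<^sub>v unit_vec n k"] smult[of "unit_vec n k" "v $ k"]
      by (simp add: mult.commute)
  qed
  from this[of n] have "f (?t n) = (\<Sum>i<n. f (unit_vec n i) * v $ i)" by simp
  moreover have "?t n = v" using v by (intro eq_vecI) auto
  ultimately show ?thesis
    using v by (simp add: scalar_prod_def atLeast0LessThan)
qed

lemma bilinear_form_matrix:
  fixes \<Phi> :: "'k::comm_ring_1 vec \<Rightarrow> 'k vec \<Rightarrow> 'k"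
  assumes "bilinear_form n \<Phi>"
  obtains H where "H \<in> carrier_mat n n"
    "\<And>u v. u \<in> carrier_vec n \<Longrightarrow> v \<in> carrier_vec n \<Longrightarrow> \<Phi> u v = (H *\<^sub>v u) \<bullet> v"
proof -
  note b = assms[unfolded bilinear_form_def]
  \<comment> \<open>The Gram matrix is transposed so that \<open>H u\<close> represents the
    functional \<Phi>(u, _).\<close>
  define H where "H = mat n n (\<lambda>(i, j). \<Phi> (unit_vec n j) (unit_vec n i))"
  have H: "H \<in> carrier_mat n n" by (simp add: H_def)
  have "\<Phi> u v = (H *\<^sub>v u) \<bullet> v" if u: "u \<in> carrier_vec n" and v: "v \<in> carrier_vec n" for u v
  proof -
    have "\<Phi> u v = vec n (\<lambda>i. \<Phi> u (unit_vec n i)) \<bullet> v"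
      by (rule linear_functional_as_scalar_prod[OF _ _ v]) (use b u in blast)+
    also have "vec n (\<lambda>i. \<Phi> u (unit_vec n i)) = H *\<^sub>v u"
    proof (rule eq_vecI)
      fix i assume "i < dim_vec (H *\<^sub>v u)"
      then have i: "i < n" using H by simp
      have "\<Phi> u (unit_vec n i) = vec n (\<lambda>j. \<Phi> (unit_vec n j) (unit_vec n i)) \<bullet> u"
        by (rule linear_functional_as_scalar_prod[of n "\<lambda>u. \<Phi> u (unit_vec n i)", OF _ _ u])
          (use b unit_vec_carrier in blast)+
      also have "vec n (\<lambda>j. \<Phi> (unit_vec n j) (unit_vec n i)) = row H i"
        using i by (intro eq_vecI) (auto simp: H_def)
      finally show "vec n (\<lambda>i. \<Phi> u (unit_vec n i)) $ i = (H *\<^sub>v u) $ i"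
        using i H by simp
    qed (use H in simp)
    finally show ?thesis .
  qed
  with H show thesis by (rule that)
qed

lemma mat_trace_smult:
  fixes M :: "'k::comm_ring_1 mat"
  shows "M \<in> carrier_mat n n \<Longrightarrow> mat_trace (c \<cdot>\<^sub>m M) = c * mat_trace M"
  by (simp add: mat_trace_def sum_distrib_left)

lemma mat_trace_outer_mult:
  fixes M :: "'k::comm_ring_1 mat"
  assumes "w \<in> carrier_vec n" "p \<in> carrier_vec n" "M \<in> carrier_mat n n"
  shows "mat_trace (outer w p * M) = p \<bullet> (M *\<^sub>v w)"
proof -
  have "mat_trace (outer w p * M) = (\<Sum>i<n. \<Sum>j<n. w $ i * p $ j * M $$ (j, i))"
    using assms by (auto simp: mat_trace_def outer_def scalar_prod_def atLeast0LessThan intro!: sum.cong)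
  also have "\<dots> = (\<Sum>j<n. \<Sum>i<n. p $ j * (M $$ (j, i) * w $ i))"
    by (subst sum.swap) (simp add: ac_simps)
  also have "\<dots> = p \<bullet> (M *\<^sub>v w)"
    using assms by (auto simp: scalar_prod_def atLeast0LessThan sum_distrib_left intro!: sum.cong)
  finally show ?thesis .
qed

text \<open>The sign \<epsilon> is 1 for a symmetric and -1 for an alternating form, so that types
  AI and AII are treated together.\<close>

locale self_adjoint_mat =
  fixes n :: nat and \<Phi> :: "'k::field_char_0 vec \<Rightarrow> 'k vec \<Rightarrow> 'k" and \<epsilon> :: 'k and e :: "'k mat"
  assumes bilinear: "bilinear_form n \<Phi>"
    and nondegenerate: "nondegenerate_form n \<Phi>"
    and sign: "\<epsilon> = 1 \<or> \<epsilon> = - 1"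
    and flip: "u \<in> carrier_vec n \<Longrightarrow> v \<in> carrier_vec n \<Longrightarrow> \<Phi> u v = \<epsilon> * \<Phi> v u"
    and e [simp, intro]: "e \<in> carrier_mat n n"
    and self_adjoint: "u \<in> carrier_vec n \<Longrightarrow> v \<in> carrier_vec n \<Longrightarrow> \<Phi> (e *\<^sub>v u) v = \<Phi> u (e *\<^sub>v v)"
begin

section \<open>Dual Jordan chains and the construction of the commuting nilpotent\<close>

lemma form_simps:
  assumes "u \<in> carrier_vec n" "v \<in> carrier_vec n" "w \<in> carrier_vec n"
  shows "\<Phi> (u + v) w = \<Phi> u w + \<Phi> v w" "\<Phi> w (u + v) = \<Phi> w u + \<Phi> w v"
    "\<Phi> (c \<cdot>\<^sub>v u) v = c * \<Phi> u v" "\<Phi> u (c \<cdot>\<^sub>v v) = c * \<Phi> u v"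
  using bilinear assms unfolding bilinear_form_def by blast+

lemma form_zero:
  assumes "u \<in> carrier_vec n"
  shows "\<Phi> (0\<^sub>v n) u = 0" "\<Phi> u (0\<^sub>v n) = 0"
proof -
  have "0 \<cdot>\<^sub>v u = 0\<^sub>v n" using assms by (intro eq_vecI) auto
  then show "\<Phi> (0\<^sub>v n) u = 0" "\<Phi> u (0\<^sub>v n) = 0"
    using form_simps(3)[OF assms assms assms, of 0] form_simps(4)[OF assms assms assms, of 0] by simp_all
qed

lemma pow_carrier [simp, intro]: "e ^\<^sub>m k \<in> carrier_mat n n"
  by simp

lemma mult_vec_carrier [simp, intro]:
  "M \<in> carrier_mat n n \<Longrightarrow> u \<in> carrier_vec n \<Longrightarrow> M *\<^sub>v u \<in> carrier_vec n"
  by simp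

lemma self_adjoint_pow:
  "u \<in> carrier_vec n \<Longrightarrow> v \<in> carrier_vec n \<Longrightarrow> \<Phi> (e ^\<^sub>m k *\<^sub>v u) v = \<Phi> u (e ^\<^sub>m k *\<^sub>v v)"
proof (induction k arbitrary: u v)
  case (Suc k)
  have 1: "e ^\<^sub>m Suc k *\<^sub>v w = e ^\<^sub>m k *\<^sub>v (e *\<^sub>v w)" if "w \<in> carrier_vec n" for w
    using mat_pow_mult_vec_add[OF e that, of k 1] that by simp
  have 2: "e ^\<^sub>m Suc k *\<^sub>v w = e *\<^sub>v (e ^\<^sub>m k *\<^sub>v w)" if "w \<in> carrier_vec n" for w
    using mat_pow_mult_vec_add[OF e that, of 1 k] that by simp
  show ?case
    using Suc.IH[of "e *\<^sub>v u" v] self_adjoint[of u "e ^\<^sub>m k *\<^sub>v v"] Suc.prems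
    unfolding 1[OF Suc.prems(1)] 2[OF Suc.prems(2)] by simp
qed (use carrier_matD[OF e] in simp)

text \<open>Nondegeneracy represents the functional \<open>p\<close> of
  \<open>jordan_nf_chain\<close> by a vector \<open>v'\<close>. As \<open>p\<close> kills the range
  of \<open>e^(b + 1)\<close>, self-adjointness makes \<open>e^(b + 1) v'\<close> orthogonal to
  everything, hence zero.\<close>

lemma dual_chain:
  assumes "nilpotent_mat e" "jordan_nf e n_as" "i < length n_as" "fst (n_as ! i) = Suc b"
  obtains v v' where "v \<in> carrier_vec n" "v' \<in> carrier_vec n"
    "e ^\<^sub>m Suc b *\<^sub>v v = 0\<^sub>v n" "e ^\<^sub>m Suc b *\<^sub>v v' = 0\<^sub>v n" "\<Phi> v' (e ^\<^sub>m b *\<^sub>v v) \<noteq> 0"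
proof -
  obtain v p where v: "v \<in> carrier_vec n" and p: "p \<in> carrier_vec n"
    and ev: "e ^\<^sub>m Suc b *\<^sub>v v = 0\<^sub>v n"
    and pe: "\<And>x. x \<in> carrier_vec n \<Longrightarrow> p \<bullet> (e ^\<^sub>m Suc b *\<^sub>v x) = 0"
    and pv: "p \<bullet> (e ^\<^sub>m b *\<^sub>v v) \<noteq> 0"
    using jordan_nf_chain[OF e assms(1-3)] assms(4) by auto
  obtain H where H: "H \<in> carrier_mat n n"
    and \<Phi>H: "\<And>u v. u \<in> carrier_vec n \<Longrightarrow> v \<in> carrier_vec n \<Longrightarrow> \<Phi> u v = (H *\<^sub>v u) \<bullet> v"
    using bilinear_form_matrix[OF bilinear] by blast
  have "det H \<noteq> 0"
  proof
    assume "det H = 0"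
    then obtain u where u: "u \<in> carrier_vec n" "u \<noteq> 0\<^sub>v n" "H *\<^sub>v u = 0\<^sub>v n"
      using det_0_iff_vec_prod_zero[OF H] by blast
    then have "\<forall>v\<in>carrier_vec n. \<Phi> u v = 0"
      using \<Phi>H by simp
    then show False
      using nondegenerate u unfolding nondegenerate_form_def by blast
  qed
  then obtain G where G: "G \<in> carrier_mat n n" "H * G = 1\<^sub>m n"
    using det_non_zero_imp_unit[OF H, of "()"] unfolding Units_def ring_mat_def by auto
  define v' where "v' = G *\<^sub>v p"
  have v': "v' \<in> carrier_vec n" using G p by (simp add: v'_def)
  have "H *\<^sub>v v' = p"
    using assoc_mult_mat_vec[OF H G(1) p] G(2) p by (simp add: v'_def)
  then have \<Phi>v': "\<Phi> v' x = p \<bullet> x" if "x \<in> carrier_vec n" for x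
    using \<Phi>H[OF v' that] by simp
  have "\<Phi> (e ^\<^sub>m Suc b *\<^sub>v v') x = 0" if "x \<in> carrier_vec n" for x
    using self_adjoint_pow[OF v' that, of "Suc b"] \<Phi>v'[of "e ^\<^sub>m Suc b *\<^sub>v x"] pe[OF that] that
    by (simp del: pow_mat.simps)
  then have "e ^\<^sub>m Suc b *\<^sub>v v' = 0\<^sub>v n"
    using nondegenerate mult_vec_carrier[OF pow_carrier v'] unfolding nondegenerate_form_def by blast
  then show thesis
    using that[OF v v' ev] \<Phi>v'[of "e ^\<^sub>m b *\<^sub>v v"] pv v by simp
qed

text \<open>For a symmetric form both ends of the dual chain can be taken equal, by polarization.\<close>

lemma dual_chain_normalized:
  assumes "nilpotent_mat e" "jordan_nf e n_as" "i < length n_as" "fst (n_as ! i) = Suc b"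
  obtains v v' where "v \<in> carrier_vec n" "v' \<in> carrier_vec n"
    "e ^\<^sub>m Suc b *\<^sub>v v = 0\<^sub>v n" "e ^\<^sub>m Suc b *\<^sub>v v' = 0\<^sub>v n" "\<Phi> v' (e ^\<^sub>m b *\<^sub>v v) \<noteq> 0"
    "\<epsilon> = 1 \<Longrightarrow> v = v'"
proof -
  obtain v v' where v: "v \<in> carrier_vec n" "v' \<in> carrier_vec n"
    and k: "e ^\<^sub>m Suc b *\<^sub>v v = 0\<^sub>v n" "e ^\<^sub>m Suc b *\<^sub>v v' = 0\<^sub>v n"
    and nz: "\<Phi> v' (e ^\<^sub>m b *\<^sub>v v) \<noteq> 0"
    by (rule dual_chain[OF assms])
  show thesis
  proof (cases "\<epsilon> = 1")
    case False
    with that[OF v k nz] show thesis by simp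
  next
    case True
    have sym: "\<Phi> v (e ^\<^sub>m b *\<^sub>v v') = \<Phi> v' (e ^\<^sub>m b *\<^sub>v v)"
      using self_adjoint_pow[OF v, of b] flip[of "e ^\<^sub>m b *\<^sub>v v" v'] True v by simp
    have "\<exists>x\<in>carrier_vec n. e ^\<^sub>m Suc b *\<^sub>v x = 0\<^sub>v n \<and> \<Phi> x (e ^\<^sub>m b *\<^sub>v x) \<noteq> 0"
    proof (rule ccontr)
      assume "\<not> ?thesis"
      then have z: "\<Phi> x (e ^\<^sub>m b *\<^sub>v x) = 0" if "x \<in> carrier_vec n" "e ^\<^sub>m Suc b *\<^sub>v x = 0\<^sub>v n" for x
        using that by blast
      have "e ^\<^sub>m Suc b *\<^sub>v (v + v') = 0\<^sub>v n"
        using mult_add_distrib_mat_vec[OF pow_carrier v, of "Suc b"] k by (simp del: pow_mat.simps)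
      then have "\<Phi> (v + v') (e ^\<^sub>m b *\<^sub>v (v + v')) = 0"
        using z v by (simp del: pow_mat.simps)
      \<comment> \<open>The diagonal terms vanish and the two mixed terms agree by
        \<open>sym\<close>.\<close>
      then have "2 * \<Phi> v' (e ^\<^sub>m b *\<^sub>v v) = 0"
        using z[OF v(1) k(1)] z[OF v(2) k(2)] sym v
        by (simp add: mult_add_distrib_mat_vec[OF pow_carrier v] form_simps)
      with nz show False by simp
    qed
    then obtain x where "x \<in> carrier_vec n" "e ^\<^sub>m Suc b *\<^sub>v x = 0\<^sub>v n" "\<Phi> x (e ^\<^sub>m b *\<^sub>v x) \<noteq> 0"
      by blast
    then show thesis using that[of x x] by blast
  qed
qed

text \<open>Supplies the surjectivity conditions \<open>A_attained\<close> and
  \<open>B_attained\<close>: the combination on the left is the relevant part of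
  \<open>Z e^k\<close> on the span of \<open>w\<close> and \<open>w'\<close>.\<close>

lemma pairing_attains:
  assumes w: "w \<in> carrier_vec n" "w' \<in> carrier_vec n" and v: "v \<in> carrier_vec n" "v' \<in> carrier_vec n"
    and nz: "\<Phi> w' (e ^\<^sub>m k *\<^sub>v w) \<noteq> 0" and eq: "\<epsilon> = 1 \<Longrightarrow> w = w' \<and> v = v'"
  shows "\<exists>\<alpha> \<beta>. \<Phi> w' (e ^\<^sub>m k *\<^sub>v (\<alpha> \<cdot>\<^sub>v w + \<beta> \<cdot>\<^sub>v w')) \<cdot>\<^sub>v v + (\<epsilon> * \<Phi> w (e ^\<^sub>m k *\<^sub>v (\<alpha> \<cdot>\<^sub>v w + \<beta> \<cdot>\<^sub>v w'))) \<cdot>\<^sub>v v'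
    = c \<cdot>\<^sub>v v + d \<cdot>\<^sub>v v'"
proof -
  let ?g = "\<Phi> w' (e ^\<^sub>m k *\<^sub>v w)"
  have lin: "\<Phi> x (e ^\<^sub>m k *\<^sub>v (\<alpha> \<cdot>\<^sub>v w + \<beta> \<cdot>\<^sub>v w')) = \<alpha> * \<Phi> x (e ^\<^sub>m k *\<^sub>v w) + \<beta> * \<Phi> x (e ^\<^sub>m k *\<^sub>v w')"
    if "x \<in> carrier_vec n" for x \<alpha> \<beta>
    using that w by (simp add: mult_add_distrib_mat_vec[of _ n n] mult_mat_vec[of _ n n] form_simps)
  show ?thesis
  proof (cases "\<epsilon> = 1")
    case True
    with eq have [simp]: "w' = w" "v' = v" by auto
    show ?thesis
      \<comment> \<open>For a symmetric form both summands coincide, which explains the factor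
        2.\<close>
      using nz True v w by (intro exI[of _ "(c + d) / (2 * ?g)"] exI[of _ 0] eq_vecI)
        (simp_all add: lin[simplified] field_simps)
  next
    case False
    then have m: "\<epsilon> = - 1" using sign by blast
    \<comment> \<open>For \<epsilon> = -1 the form \<Phi>(x, e^k y) is skew, so \<open>w\<close>
      affects only the coefficient of \<open>v\<close>, and \<open>w'\<close> only that of
      \<open>v'\<close>.\<close>
    have skew: "\<Phi> x (e ^\<^sub>m k *\<^sub>v y) = - \<Phi> y (e ^\<^sub>m k *\<^sub>v x)" if "x \<in> carrier_vec n" "y \<in> carrier_vec n" for x y
      using self_adjoint_pow[OF that(2,1), of k] flip[of "x" "e ^\<^sub>m k *\<^sub>v y"] m that by simp
    have zero: "\<Phi> x (e ^\<^sub>m k *\<^sub>v x) = 0" if "x \<in> carrier_vec n" for x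
      using skew[OF that that] by simp
    show ?thesis
      using nz m v w skew[OF w] zero[OF w(1)] zero[OF w(2)]
      by (intro exI[of _ "c / ?g"] exI[of _ "d / ?g"]) (simp add: lin)
  qed
qed

text \<open>The blocks of sizes \<open>a\<close> and \<open>a + 1\<close> provide the generators
  \<open>w, w'\<close> and \<open>v, v'\<close>. Their spans and the map \<open>Z\<close> form an
  adapted pair, and the resulting \<open>Y\<close> is the required matrix.\<close>

lemma exists_commuting_rank_increase:
  assumes nil: "nilpotent_mat e" and nf: "jordan_nf e n_as"
    and i: "i < length n_as" "fst (n_as ! i) = a" "0 < a"
    and j: "j < length n_as" "fst (n_as ! j) = Suc a"
  shows "\<exists>y\<in>carrier_mat n n. (\<forall>u\<in>carrier_vec n. \<forall>v\<in>carrier_vec n. \<Phi> (y *\<^sub>v u) v = \<Phi> u (y *\<^sub>v v)) \<and>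
    nilpotent_mat y \<and> mat_trace y = 0 \<and> e * y = y * e \<and> vec_space.rank n e < vec_space.rank n (e + y)"
proof -
  obtain a' where a': "a = Suc a'" using i(3) by (cases a) auto
  obtain w w' where w: "w \<in> carrier_vec n" "w' \<in> carrier_vec n"
    and ew: "e ^\<^sub>m a *\<^sub>v w = 0\<^sub>v n" "e ^\<^sub>m a *\<^sub>v w' = 0\<^sub>v n"
    and nw: "\<Phi> w' (e ^\<^sub>m a' *\<^sub>v w) \<noteq> 0" and sw: "\<epsilon> = 1 \<Longrightarrow> w = w'"
    using dual_chain_normalized[OF nil nf i(1), of a'] i(2) a' by metis
  obtain v v' where v: "v \<in> carrier_vec n" "v' \<in> carrier_vec n"
    and ev: "e ^\<^sub>m Suc a *\<^sub>v v = 0\<^sub>v n" "e ^\<^sub>m Suc a *\<^sub>v v' = 0\<^sub>v n"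
    and nv: "\<Phi> v' (e ^\<^sub>m a *\<^sub>v v) \<noteq> 0" and sv: "\<epsilon> = 1 \<Longrightarrow> v = v'"
    using dual_chain_normalized[OF nil nf j] by metis
  obtain H where H: "H \<in> carrier_mat n n"
    and \<Phi>H: "\<And>u v. u \<in> carrier_vec n \<Longrightarrow> v \<in> carrier_vec n \<Longrightarrow> \<Phi> u v = (H *\<^sub>v u) \<bullet> v"
    using bilinear_form_matrix[OF bilinear] by blast
  have Hc: "H *\<^sub>v u \<in> carrier_vec n" if "u \<in> carrier_vec n" for u using H that by simp
  \<comment> \<open>The rank one map sending \<open>u\<close> to \<Phi>(p, u) x.\<close>
  define R where "R x p = outer x (H *\<^sub>v p)" for x p
  have R: "R x p \<in> carrier_mat n n" if "x \<in> carrier_vec n" "p \<in> carrier_vec n" for x p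
    using that Hc unfolding R_def by blast
  have Rv: "R x p *\<^sub>v u = \<Phi> p u \<cdot>\<^sub>v x"
    if "x \<in> carrier_vec n" "p \<in> carrier_vec n" "u \<in> carrier_vec n" for x p u
    unfolding R_def using outer_mult_vec[OF that(1) Hc[OF that(2)] that(3)] \<Phi>H[OF that(2,3)] by simp
  \<comment> \<open>The adjoint of \<open>R x p\<close> is \<epsilon> times \<open>R p x\<close>.
    Hence the first and fourth summands are adjoint to each other, and so are the second and
    third.\<close>
  define Z where "Z = (R w v' + \<epsilon> \<cdot>\<^sub>m R w' v) + (R v w' + \<epsilon> \<cdot>\<^sub>m R v' w)"
  have Z: "Z \<in> carrier_mat n n"
    unfolding Z_def using R v w by auto
  have Zv: "Z *\<^sub>v u = (\<Phi> v' u \<cdot>\<^sub>v w + (\<epsilon> * \<Phi> v u) \<cdot>\<^sub>v w') + (\<Phi> w' u \<cdot>\<^sub>v v + (\<epsilon> * \<Phi> w u) \<cdot>\<^sub>v v')"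
    if u: "u \<in> carrier_vec n" for u
  proof -
    have sm: "(\<epsilon> \<cdot>\<^sub>m R x p) *\<^sub>v u = (\<epsilon> * \<Phi> p u) \<cdot>\<^sub>v x" if "x \<in> carrier_vec n" "p \<in> carrier_vec n" for x p
    proof -
      have "(\<epsilon> \<cdot>\<^sub>m R x p) *\<^sub>v u = \<epsilon> \<cdot>\<^sub>v (R x p *\<^sub>v u)"
        using R[OF that] u by (intro eq_vecI) auto
      then show ?thesis using Rv[OF that u] by (simp add: smult_smult_assoc)
    qed
    show ?thesis
      unfolding Z_def
      using R v w u by (simp add: add_mult_distrib_mat_vec[of _ n n] sm Rv)
  qed
  have \<Phi>e: "\<Phi> x (e ^\<^sub>m k *\<^sub>v u) = 0" if "x \<in> carrier_vec n" "u \<in> carrier_vec n" "e ^\<^sub>m k *\<^sub>v x = 0\<^sub>v n" for x u k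
    using self_adjoint_pow[OF that(1,2), of k] that(3) form_zero[OF that(2)] by simp
  define A where "A = {c \<cdot>\<^sub>v w + d \<cdot>\<^sub>v w' | c d. True}"
  define B where "B = {c \<cdot>\<^sub>v v + d \<cdot>\<^sub>v v' | c d. True}"
  have A: "c \<cdot>\<^sub>v w + d \<cdot>\<^sub>v w' \<in> A" and B: "c \<cdot>\<^sub>v v + d \<cdot>\<^sub>v v' \<in> B" for c d
    unfolding A_def B_def by blast+
  have Zea: "Z *\<^sub>v (e ^\<^sub>m a *\<^sub>v u) = \<Phi> v' (e ^\<^sub>m a *\<^sub>v u) \<cdot>\<^sub>v w + (\<epsilon> * \<Phi> v (e ^\<^sub>m a *\<^sub>v u)) \<cdot>\<^sub>v w'"
    if u: "u \<in> carrier_vec n" for u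
  proof -
    have "Z *\<^sub>v (e ^\<^sub>m a *\<^sub>v u) = (\<Phi> v' (e ^\<^sub>m a *\<^sub>v u) \<cdot>\<^sub>v w + (\<epsilon> * \<Phi> v (e ^\<^sub>m a *\<^sub>v u)) \<cdot>\<^sub>v w') + (0 \<cdot>\<^sub>v v + (\<epsilon> * 0) \<cdot>\<^sub>v v')"
      using Zv[of "e ^\<^sub>m a *\<^sub>v u"] \<Phi>e[OF w(1) u ew(1)] \<Phi>e[OF w(2) u ew(2)] u by simp
    also have "0 \<cdot>\<^sub>v v + (\<epsilon> * 0) \<cdot>\<^sub>v v' = 0\<^sub>v n"
      using v by (intro eq_vecI) auto
    finally show ?thesis using v w by simp
  qed
  have eb_w: "e ^\<^sub>m Suc a *\<^sub>v w = 0\<^sub>v n" "e ^\<^sub>m Suc a *\<^sub>v w' = 0\<^sub>v n"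
    using mat_pow_mult_vec_add[OF e w(1), of 1 a] mat_pow_mult_vec_add[OF e w(2), of 1 a]
      ew mult_mat_zero_vec[OF pow_carrier, of 1] by (simp_all del: pow_mat.simps)
  \<comment> \<open>Both products vanish: all four generators are killed by \<open>e^(a + 1)\<close>
    and thus also orthogonal to its range.\<close>
  have comm: "e ^\<^sub>m Suc a * Z = Z * e ^\<^sub>m Suc a"
  proof (rule mat_eqI_mult_vec)
    fix u :: "'k vec" assume u: "u \<in> carrier_vec n"
    let ?E = "e ^\<^sub>m Suc a"
    have "?E *\<^sub>v (Z *\<^sub>v u) = 0\<^sub>v n"
      unfolding Zv[OF u] using v w
      by (simp add: mult_add_distrib_mat_vec[OF pow_carrier] mult_mat_vec[OF pow_carrier] eb_w ev smult_zero_vec del: pow_mat.simps)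
    moreover have "Z *\<^sub>v (?E *\<^sub>v u) = 0\<^sub>v n"
    proof -
      have "Z *\<^sub>v (?E *\<^sub>v u) = (0 \<cdot>\<^sub>v w + (\<epsilon> * 0) \<cdot>\<^sub>v w') + (0 \<cdot>\<^sub>v v + (\<epsilon> * 0) \<cdot>\<^sub>v v')"
        using Zv[of "?E *\<^sub>v u"] \<Phi>e[OF w(1) u eb_w(1)] \<Phi>e[OF w(2) u eb_w(2)] \<Phi>e[OF v(1) u ev(1)] \<Phi>e[OF v(2) u ev(2)] u
        by (simp del: pow_mat.simps)
      also have "\<dots> = 0\<^sub>v n" using v w by (intro eq_vecI) auto
      finally show ?thesis .
    qed
    ultimately show "(?E * Z) *\<^sub>v u = (Z * ?E) *\<^sub>v u"
      using assoc_mult_mat_vec[OF pow_carrier Z u, of "Suc a"] assoc_mult_mat_vec[OF Z pow_carrier u, of "Suc a"]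
      by (simp del: pow_mat.simps)
  qed (use Z mult_carrier_mat[OF pow_carrier Z] mult_carrier_mat[OF Z pow_carrier] in blast)+
  interpret P: adapted_mat_pair n e Z A B a
  proof
    show "e \<in> carrier_mat n n" "Z \<in> carrier_mat n n" by (fact e Z)+
    show "0 < a" by (fact i(3))
    show "\<exists>m. e ^\<^sub>m m = 0\<^sub>m n n"
      using nil carrier_matD[OF e] unfolding nilpotent_mat_def by simp
    show "e ^\<^sub>m Suc a * Z = Z * e ^\<^sub>m Suc a" by (fact comm)
    show "A \<subseteq> carrier_vec n" "B \<subseteq> carrier_vec n"
      using v w unfolding A_def B_def by auto
    show "\<exists>x\<in>A. \<exists>x'\<in>B. Z *\<^sub>v u = x + x'" if "u \<in> carrier_vec n" for u
      using Zv[OF that] A B by blast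
    show "Z *\<^sub>v (e ^\<^sub>m a *\<^sub>v u) \<in> A" if "u \<in> carrier_vec n" for u
      unfolding Zea[OF that] by (rule A)
    show "\<exists>x\<in>A. \<exists>x''\<in>A. Z *\<^sub>v (e ^\<^sub>m (a - 1) *\<^sub>v x) = x'' + x'" if x'B: "x' \<in> B" for x'
    proof -
      obtain c d where x': "x' = c \<cdot>\<^sub>v v + d \<cdot>\<^sub>v v'" using x'B unfolding B_def by blast
      have "\<exists>\<alpha> \<beta>. \<Phi> w' (e ^\<^sub>m a' *\<^sub>v (\<alpha> \<cdot>\<^sub>v w + \<beta> \<cdot>\<^sub>v w')) \<cdot>\<^sub>v v +
          (\<epsilon> * \<Phi> w (e ^\<^sub>m a' *\<^sub>v (\<alpha> \<cdot>\<^sub>v w + \<beta> \<cdot>\<^sub>v w'))) \<cdot>\<^sub>v v' = x'"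
        unfolding x' by (rule pairing_attains[OF w v nw]) (use sv sw in blast)
      then obtain x where x: "x \<in> A"
        "\<Phi> w' (e ^\<^sub>m a' *\<^sub>v x) \<cdot>\<^sub>v v + (\<epsilon> * \<Phi> w (e ^\<^sub>m a' *\<^sub>v x)) \<cdot>\<^sub>v v' = x'"
        using A by blast
      have xc: "x \<in> carrier_vec n" using x(1) w unfolding A_def by auto
      show ?thesis
        using Zv[of "e ^\<^sub>m a' *\<^sub>v x"] x xc A a' by fastforce
    qed
    show "\<exists>x'\<in>B. Z *\<^sub>v (e ^\<^sub>m a *\<^sub>v x') = x" if xA: "x \<in> A" for x
    proof -
      obtain c d where x: "x = c \<cdot>\<^sub>v w + d \<cdot>\<^sub>v w'" using xA unfolding A_def by blast
      have "\<exists>\<alpha> \<beta>. \<Phi> v' (e ^\<^sub>m a *\<^sub>v (\<alpha> \<cdot>\<^sub>v v + \<beta> \<cdot>\<^sub>v v')) \<cdot>\<^sub>v w +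
          (\<epsilon> * \<Phi> v (e ^\<^sub>m a *\<^sub>v (\<alpha> \<cdot>\<^sub>v v + \<beta> \<cdot>\<^sub>v v'))) \<cdot>\<^sub>v w' = x"
        unfolding x by (rule pairing_attains[OF v w nv]) (use sv sw in blast)
      then obtain x' where x': "x' \<in> B"
        "\<Phi> v' (e ^\<^sub>m a *\<^sub>v x') \<cdot>\<^sub>v w + (\<epsilon> * \<Phi> v (e ^\<^sub>m a *\<^sub>v x')) \<cdot>\<^sub>v w' = x"
        using B by blast
      have "x' \<in> carrier_vec n" using x'(1) v unfolding B_def by auto
      then show ?thesis
        using Zea x' by (intro bexI[of _ x']) simp_all
    qed
    show "e ^\<^sub>m a *\<^sub>v x = 0\<^sub>v n" if "x \<in> A" for x
      using that w ew unfolding A_def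
      by (auto simp: mult_add_distrib_mat_vec[OF pow_carrier] mult_mat_vec[OF pow_carrier] smult_zero_vec)
    show "\<exists>x\<in>A. \<forall>u\<in>carrier_vec n. e *\<^sub>v u \<noteq> x"
    proof (intro bexI ballI notI)
      fix u assume u: "u \<in> carrier_vec n" and "e *\<^sub>v u = w"
      then have "e ^\<^sub>m a' *\<^sub>v w = e ^\<^sub>m a *\<^sub>v u"
        \<comment> \<open>A preimage \<open>u\<close> of \<open>w\<close> would put
          \<open>e^(a - 1) w\<close> into the range of \<open>e^a\<close>, which is orthogonal to
          \<open>w'\<close>; this contradicts \<open>nw\<close>.\<close>
        using mat_pow_mult_vec_add[OF e u, of a' 1] carrier_matD[OF e] a' left_mult_one_mat[OF e] by auto
      then show False
        using nw \<Phi>e[OF w(2) u ew(2)] by simp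
    next
      have "w = 1 \<cdot>\<^sub>v w + 0 \<cdot>\<^sub>v w'" using w by (intro eq_vecI) auto
      then show "w \<in> A" using A by metis
    qed
  qed
  have Zadj: "\<Phi> (Z *\<^sub>v x) y = \<Phi> x (Z *\<^sub>v y)" if x: "x \<in> carrier_vec n" and y: "y \<in> carrier_vec n" for x y
  proof -
    have sq: "\<epsilon> * \<epsilon> = 1" using sign by auto
    have l: "\<Phi> (Z *\<^sub>v x) y = \<Phi> v' x * \<Phi> w y + \<epsilon> * \<Phi> v x * \<Phi> w' y + (\<Phi> w' x * \<Phi> v y + \<epsilon> * \<Phi> w x * \<Phi> v' y)"
      unfolding Zv[OF x] using v w x y by (simp add: form_simps)
    have "\<Phi> x (Z *\<^sub>v y) = \<Phi> v' y * \<Phi> x w + \<epsilon> * \<Phi> v y * \<Phi> x w' + (\<Phi> w' y * \<Phi> x v + \<epsilon> * \<Phi> w y * \<Phi> x v')"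
      unfolding Zv[OF y] using v w x y by (simp add: form_simps)
    also have "\<dots> = \<Phi> v' y * (\<epsilon> * \<Phi> w x) + \<epsilon> * \<Phi> v y * (\<epsilon> * \<Phi> w' x) +
        (\<Phi> w' y * (\<epsilon> * \<Phi> v x) + \<epsilon> * \<Phi> w y * (\<epsilon> * \<Phi> v' x))"
      using flip[OF x w(1)] flip[OF x w(2)] flip[OF x v(1)] flip[OF x v(2)] by simp
    also have "\<dots> = \<Phi> v' y * (\<epsilon> * \<Phi> w x) + (\<epsilon> * \<epsilon>) * (\<Phi> v y * \<Phi> w' x) +
        (\<Phi> w' y * (\<epsilon> * \<Phi> v x) + (\<epsilon> * \<epsilon>) * (\<Phi> w y * \<Phi> v' x))"
      by (simp only: ac_simps)
    finally show ?thesis unfolding l sq by (simp add: ac_simps)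
  qed
  \<comment> \<open>Passing to adjoints reverses products, so the left recursion for
    \<open>y\<close> turns into the right one.\<close>
  have yadj: "\<Phi> (power_derivation e Z k *\<^sub>v x) x' = \<Phi> x (power_derivation e Z k *\<^sub>v x')"
    if "x \<in> carrier_vec n" "x' \<in> carrier_vec n" for k x x'
    using that
  proof (induction k arbitrary: x x')
    case 0
    then show ?case
      using zero_mat_mult_vec[OF 0(1), of n] zero_mat_mult_vec[OF 0(2), of n] form_zero by simp
  next
    case (Suc k)
    let ?y = "power_derivation e Z k"
    have "\<Phi> (power_derivation e Z (Suc k) *\<^sub>v x) x' = \<Phi> (e *\<^sub>v (?y *\<^sub>v x)) x' + \<Phi> (Z *\<^sub>v (e ^\<^sub>m k *\<^sub>v x)) x'"
      unfolding P.y_Suc_mult_vec(1)[OF Suc.prems(1)]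
      using Suc.prems Z P.y_carrier[of k] by (intro form_simps(1)[of _ _ x']) auto
    also have "\<Phi> (e *\<^sub>v (?y *\<^sub>v x)) x' = \<Phi> x (?y *\<^sub>v (e *\<^sub>v x'))"
      using self_adjoint[of "?y *\<^sub>v x" x'] Suc.IH[of x "e *\<^sub>v x'"] Suc.prems by simp
    also have "\<Phi> (Z *\<^sub>v (e ^\<^sub>m k *\<^sub>v x)) x' = \<Phi> x (e ^\<^sub>m k *\<^sub>v (Z *\<^sub>v x'))"
      using Zadj[of "e ^\<^sub>m k *\<^sub>v x" x'] self_adjoint_pow[of x "Z *\<^sub>v x'" k] Suc.prems Z by simp
    also have "\<Phi> x (?y *\<^sub>v (e *\<^sub>v x')) + \<Phi> x (e ^\<^sub>m k *\<^sub>v (Z *\<^sub>v x')) = \<Phi> x (?y *\<^sub>v (e *\<^sub>v x') + e ^\<^sub>m k *\<^sub>v (Z *\<^sub>v x'))"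
      using Suc.prems Z P.y_carrier[of k] by (intro form_simps(2)[of _ _ x, symmetric]) auto
    also have "\<dots> = \<Phi> x (power_derivation e Z (Suc k) *\<^sub>v x')"
      unfolding P.y_Suc_mult_vec(2)[OF Suc.prems(2)] ..
    finally show ?case .
  qed
  \<comment> \<open>Each of the four trace terms pairs a vector killed by \<open>e^a\<close> with
    another one through \<open>e^a\<close>, hence is zero.\<close>
  have "mat_trace (Z * e ^\<^sub>m a) = 0"
  proof -
    let ?E = "e ^\<^sub>m a"
    have tR: "mat_trace (R x p * ?E) = \<Phi> p (?E *\<^sub>v x)" if "x \<in> carrier_vec n" "p \<in> carrier_vec n" for x p
      unfolding R_def using mat_trace_outer_mult[OF that(1) Hc[OF that(2)] pow_carrier]
        \<Phi>H[OF that(2) mult_vec_carrier[OF pow_carrier that(1)]] by simp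
    have tsR: "mat_trace (\<epsilon> \<cdot>\<^sub>m R x p * ?E) = \<epsilon> * \<Phi> p (?E *\<^sub>v x)" if "x \<in> carrier_vec n" "p \<in> carrier_vec n" for x p
    proof -
      have "\<epsilon> \<cdot>\<^sub>m R x p * ?E = \<epsilon> \<cdot>\<^sub>m (R x p * ?E)"
        using R[OF that] by (intro mult_smult_assoc_mat[OF _ pow_carrier])
      then show ?thesis
        using tR[OF that] mat_trace_smult[OF mult_carrier_mat[OF R[OF that] pow_carrier]] by simp
    qed
    have c: "R w v' \<in> carrier_mat n n" "\<epsilon> \<cdot>\<^sub>m R w' v \<in> carrier_mat n n" "R v w' \<in> carrier_mat n n" "\<epsilon> \<cdot>\<^sub>m R v' w \<in> carrier_mat n n"
      using R v w by auto
    have "mat_trace (Z * ?E) = mat_trace (R w v' * ?E) + mat_trace (\<epsilon> \<cdot>\<^sub>m R w' v * ?E) +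
        (mat_trace (R v w' * ?E) + mat_trace (\<epsilon> \<cdot>\<^sub>m R v' w * ?E))"
      unfolding Z_def using c
      by (simp add: add_mult_distrib_mat[of _ n n _ _ n] mat_trace_add[of _ n] mult_carrier_mat[of _ n n _ n])
    also have "\<dots> = \<Phi> v' (?E *\<^sub>v w) + \<epsilon> * \<Phi> v (?E *\<^sub>v w') + (\<Phi> w' (?E *\<^sub>v v) + \<epsilon> * \<Phi> w (?E *\<^sub>v v'))"
      using v w by (simp add: tR tsR)
    also have "\<dots> = 0"
      using ew form_zero v w \<Phi>e[OF w(1) v(2) ew(1)] \<Phi>e[OF w(2) v(1) ew(2)] by simp
    finally show ?thesis .
  qed
  then have "mat_trace P.Y = 0"
    unfolding P.mat_trace_Y by simp
  then show ?thesis
    using P.Y_carrier P.nilpotent_Y P.Y_commute P.rank_less yadj unfolding P.s_def P.Y_def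
    by (intro bexI[of _ "power_derivation e Z (Suc a)"]) blast+
qed

end

section \<open>The nilpotent commuting variety\<close>

text \<open>Instead of the binomial expansion, induction on \<open>k\<close> shows that
  \<open>x^i y^j (x + y)^k\<close> vanishes once \<open>i + j + k\<close> reaches
  \<open>p + q\<close>: one factor \<open>x + y\<close> is distributed over the two powers.\<close>

lemma nilpotent_mat_add_commuting:
  fixes x y :: "'k::comm_ring_1 mat"
  assumes x: "x \<in> carrier_mat n n" and y: "y \<in> carrier_mat n n" and xy: "x * y = y * x"
    and nx: "nilpotent_mat x" and ny: "nilpotent_mat y"
  shows "nilpotent_mat (x + y)"
proof -
  obtain p q where p: "x ^\<^sub>m p = 0\<^sub>m n n" and q: "y ^\<^sub>m q = 0\<^sub>m n n"
    using nx ny x y unfolding nilpotent_mat_def by auto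
  let ?s = "x + y"
  have s: "?s \<in> carrier_mat n n" using x y by simp
  have c: "x ^\<^sub>m i \<in> carrier_mat n n" "y ^\<^sub>m i \<in> carrier_mat n n" "?s ^\<^sub>m i \<in> carrier_mat n n" for i
    by (rule pow_carrier_mat[OF x] pow_carrier_mat[OF y] pow_carrier_mat[OF s])+
  have yx: "y ^\<^sub>m j * x = x * y ^\<^sub>m j" for j
  proof (induction j)
    case (Suc j)
    have "y ^\<^sub>m Suc j * x = y ^\<^sub>m j * (x * y)"
      using assoc_mult_mat[OF c(2) y x] xy by simp
    also have "\<dots> = x * y ^\<^sub>m j * y"
      using assoc_mult_mat[OF c(2) x y, of j] Suc by (simp only:)
    also have "\<dots> = x * y ^\<^sub>m Suc j"
      using assoc_mult_mat[OF x c(2) y] by simp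
    finally show ?case .
  qed (use x y in simp)
  have "x ^\<^sub>m i * y ^\<^sub>m j * ?s ^\<^sub>m k = 0\<^sub>m n n" if "p + q \<le> i + j + k" for i j k
    using that
  proof (induction k arbitrary: i j)
    case 0
    have "x ^\<^sub>m i * y ^\<^sub>m j = 0\<^sub>m n n"
    proof (cases "p \<le> i")
      case True
      then have "x ^\<^sub>m i = 0\<^sub>m n n"
        using mat_pow_add[OF x, of p "i - p"] p left_mult_zero_mat[OF c(1)] by simp
      then show ?thesis using left_mult_zero_mat[OF c(2)] by simp
    next
      case False
      then have "q \<le> j" using 0 by simp
      then have "y ^\<^sub>m j = 0\<^sub>m n n"
        using mat_pow_add[OF y, of q "j - q"] q left_mult_zero_mat[OF c(2)] by simp
      then show ?thesis using right_mult_zero_mat[OF c(1)] by simp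
    qed
    then show ?case using left_mult_zero_mat[OF c(3)[of 0]] by simp
  next
    case (Suc k)
    have ss: "?s ^\<^sub>m Suc k = ?s * ?s ^\<^sub>m k"
      using mat_pow_add[OF s, of 1 k] s by simp
    have cc: "x ^\<^sub>m i * y ^\<^sub>m j \<in> carrier_mat n n" "x ^\<^sub>m i * y ^\<^sub>m j * x \<in> carrier_mat n n" "x ^\<^sub>m i * y ^\<^sub>m j * y \<in> carrier_mat n n"
      using c x y by (auto intro!: mult_carrier_mat[of _ n n _ n])
    have "x ^\<^sub>m i * y ^\<^sub>m j * ?s ^\<^sub>m Suc k = x ^\<^sub>m i * y ^\<^sub>m j * ?s * ?s ^\<^sub>m k"
      unfolding ss using assoc_mult_mat[OF cc(1) s c(3)] by simp
    also have "x ^\<^sub>m i * y ^\<^sub>m j * ?s = x ^\<^sub>m i * y ^\<^sub>m j * x + x ^\<^sub>m i * y ^\<^sub>m j * y"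
      by (rule mult_add_distrib_mat[OF cc(1) x y])
    also have "x ^\<^sub>m i * y ^\<^sub>m j * x = x ^\<^sub>m Suc i * y ^\<^sub>m j"
      using assoc_mult_mat[OF c(1,2) x] assoc_mult_mat[OF c(1) x c(2)] yx by simp
    also have "x ^\<^sub>m i * y ^\<^sub>m j * y = x ^\<^sub>m i * y ^\<^sub>m Suc j"
      using assoc_mult_mat[OF c(1,2) y] by simp
    also have "(x ^\<^sub>m Suc i * y ^\<^sub>m j + x ^\<^sub>m i * y ^\<^sub>m Suc j) * ?s ^\<^sub>m k =
        x ^\<^sub>m Suc i * y ^\<^sub>m j * ?s ^\<^sub>m k + x ^\<^sub>m i * y ^\<^sub>m Suc j * ?s ^\<^sub>m k"
      by (rule add_mult_distrib_mat[OF mult_carrier_mat[OF c(1,2)] mult_carrier_mat[OF c(1,2)] c(3)])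
    also have "\<dots> = 0\<^sub>m n n"
      using Suc.IH[of "Suc i" j] Suc.IH[of i "Suc j"] Suc.prems by simp
    finally show ?case .
  qed
  from this[of 0 0 "p + q"] have "?s ^\<^sub>m (p + q) = 0\<^sub>m n n"
    using x y left_mult_one_mat[OF one_carrier_mat[of n]] left_mult_one_mat[OF c(3)] by simp
  then show ?thesis
    unfolding nilpotent_mat_def using s by (metis carrier_matD(1))
qed

lemma smult_pow_mat:
  fixes y :: "'k::comm_ring_1 mat"
  assumes "y \<in> carrier_mat n n"
  shows "(t \<cdot>\<^sub>m y) ^\<^sub>m k = t ^ k \<cdot>\<^sub>m y ^\<^sub>m k"
proof (induction k)
  case 0
  show ?case using assms by (intro eq_matI) auto
next
  case (Suc k)
  have c: "y ^\<^sub>m k \<in> carrier_mat n n" using assms by simp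
  have "(t \<cdot>\<^sub>m y) ^\<^sub>m Suc k = (t ^ k \<cdot>\<^sub>m y ^\<^sub>m k) * (t \<cdot>\<^sub>m y)" using Suc by simp
  also have "\<dots> = t \<cdot>\<^sub>m (t ^ k \<cdot>\<^sub>m (y ^\<^sub>m k * y))"
    using mult_smult_distrib[OF smult_carrier_mat[OF c] assms] mult_smult_assoc_mat[OF c assms] by simp
  also have "\<dots> = t ^ Suc k \<cdot>\<^sub>m y ^\<^sub>m Suc k"
    using c assms by (intro eq_matI) (auto simp: mult.assoc)
  finally show ?case .
qed

lemma nilpotent_mat_smult:
  fixes y :: "'k::comm_ring_1 mat"
  assumes "y \<in> carrier_mat n n" "nilpotent_mat y"
  shows "nilpotent_mat (t \<cdot>\<^sub>m y)"
proof -
  obtain k where "y ^\<^sub>m k = 0\<^sub>m n n"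
    using assms unfolding nilpotent_mat_def by auto
  then have "(t \<cdot>\<^sub>m y) ^\<^sub>m k = 0\<^sub>m n n"
    using smult_pow_mat[OF assms(1), of t k] by auto
  then show ?thesis
    unfolding nilpotent_mat_def using assms(1) by auto
qed

lemma lie_bracket_eq_0_iff:
  fixes x y :: "'k::ring mat"
  assumes "x \<in> carrier_mat n n" "y \<in> carrier_mat n n"
  shows "lie_bracket x y = 0\<^sub>m n n \<longleftrightarrow> x * y = y * x"
proof
  have c: "x * y \<in> carrier_mat n n" "y * x \<in> carrier_mat n n"
    using assms by auto
  show "x * y = y * x" if "lie_bracket x y = 0\<^sub>m n n"
  proof (rule eq_matI)
    fix i j assume "i < dim_row (y * x)" "j < dim_col (y * x)"
    then show "(x * y) $$ (i, j) = (y * x) $$ (i, j)"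
      using arg_cong[OF that, of "\<lambda>M. M $$ (i, j)"] c assms unfolding lie_bracket_def
      by (auto simp del: index_mult_mat(1))
  qed (use assms in auto)
  show "lie_bracket x y = 0\<^sub>m n n" if "x * y = y * x"
    unfolding lie_bracket_def using that c by simp
qed

section \<open>Shears of the nilpotent commuting variety\<close>

lemma pp_carrier: "x \<in> pp n \<theta> \<Longrightarrow> x \<in> carrier_mat n n"
  by (simp add: pp_def sl_def)

lemma sl_smult: "x \<in> sl n \<Longrightarrow> c \<cdot>\<^sub>m x \<in> sl n"
  by (auto simp: sl_def mat_trace_smult[of _ n])

lemma sl_add: "x \<in> sl n \<Longrightarrow> y \<in> sl n \<Longrightarrow> x + y \<in> sl n"
  by (auto simp: sl_def mat_trace_add[of _ n])

lemma nil_commuting_variety_shear: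
  fixes x y :: "'k::comm_ring_1 mat"
  assumes \<theta>: "nontrivial_involution n \<theta>" and xy: "(x, y) \<in> nil_commuting_variety n \<theta>"
  shows "(x + t \<cdot>\<^sub>m y, y) \<in> nil_commuting_variety n \<theta>"
proof -
  have x: "x \<in> pp n \<theta>" "nilpotent_mat x" and y: "y \<in> pp n \<theta>" "nilpotent_mat y"
    and br: "lie_bracket x y = 0\<^sub>m n n"
    using xy unfolding nil_commuting_variety_def nilpotents_def by auto
  note c = pp_carrier[OF x(1)] pp_carrier[OF y(1)]
  have ty: "t \<cdot>\<^sub>m y \<in> carrier_mat n n" using c by simp
  have comm: "x * y = y * x" using br lie_bracket_eq_0_iff[OF c] by simp
  have sl: "x \<in> sl n" "y \<in> sl n" "t \<cdot>\<^sub>m y \<in> sl n" and neg: "\<theta> x = - x" "\<theta> y = - y"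
    using x(1) y(1) sl_smult unfolding pp_def by auto
  have "\<theta> (x + t \<cdot>\<^sub>m y) = \<theta> x + t \<cdot>\<^sub>m \<theta> y"
    using \<theta> sl unfolding nontrivial_involution_def by simp
  also have "\<dots> = - (x + t \<cdot>\<^sub>m y)"
    unfolding neg using c by (intro eq_matI) auto
  finally have pp: "x + t \<cdot>\<^sub>m y \<in> pp n \<theta>"
    using sl_add[OF sl(1,3)] unfolding pp_def by simp
  have comm1: "x * (t \<cdot>\<^sub>m y) = t \<cdot>\<^sub>m y * x"
    using mult_smult_distrib[OF c] mult_smult_assoc_mat[OF c(2,1)] comm by simp
  have nil: "nilpotent_mat (x + t \<cdot>\<^sub>m y)"
    by (rule nilpotent_mat_add_commuting[OF c(1) ty comm1 x(2) nilpotent_mat_smult[OF c(2) y(2)]])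
  have "(x + t \<cdot>\<^sub>m y) * y = y * (x + t \<cdot>\<^sub>m y)"
    using add_mult_distrib_mat[OF c(1) ty c(2)] mult_add_distrib_mat[OF c(2,1) ty] comm
      mult_smult_distrib[OF c(2,2)] mult_smult_assoc_mat[OF c(2,2)] by simp
  then have "lie_bracket (x + t \<cdot>\<^sub>m y) y = 0\<^sub>m n n"
    using lie_bracket_eq_0_iff[OF add_carrier_mat[OF ty] c(2)] by blast
  with pp nil y show ?thesis
    unfolding nil_commuting_variety_def nilpotents_def by simp
qed

section \<open>Rank of the first coordinate on \<open>C_variety\<close>\<close>

lemma conj_act_one:
  fixes x :: "'k::comm_ring_1 mat"
  assumes "x \<in> carrier_mat n n"
  shows "conj_act n (1\<^sub>m n) x = x"
proof -
  have "inv\<^bsub>SL_group n\<^esub> (1\<^sub>m n) = (1\<^sub>m n :: 'k mat)"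
    unfolding m_inv_def SL_group_def by (rule the_equality) auto
  then show ?thesis using assms by (simp add: conj_act_def)
qed

text \<open>If \<open>x + M\<close> is invertible with \<open>rank M \<le> n - rank x < n - rank e\<close>, then the polynomial
  \<open>det (\<cdot> + M)\<close> vanishes on all conjugates of \<open>e\<close> but not at \<open>x\<close>.\<close>

lemma C_variety_rank_le:
  fixes e :: "'k::field mat"
  assumes K: "subgroup K (SL_group n)" and e: "e \<in> carrier_mat n n"
    and p: "(x, y) \<in> C_variety n \<theta> K e"
  shows "vec_space.rank n x \<le> vec_space.rank n e"
proof (rule ccontr)
  interpret V: vec_space "TYPE('k)" n .
  let ?S = "{(conj_act n g e, conj_act n g y) | g y. g \<in> K \<and> y \<in> nilpotents n \<theta> \<inter> pp_centralizer n \<theta> e}"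
  have "x \<in> carrier_mat n n"
    using p closure_of_subset_topspace[of "mat_pair_zariski n" ?S]
    unfolding C_variety_def by (auto simp: mat_pair_zariski_def)
  then obtain M where M: "M \<in> carrier_mat n n" "det (x + M) \<noteq> 0" "V.rank x + V.rank M \<le> n"
    using V.exists_invertible_completion by blast
  assume "\<not> V.rank x \<le> V.rank e"
  then have less: "V.rank e + V.rank M < n" using M(3) by simp
  have "?S \<subseteq> {p \<in> carrier_mat n n \<times> carrier_mat n n. det (fst p + M) = 0}"
  proof safe
    fix g y assume g: "g \<in> K" and "y \<in> nilpotents n \<theta>"
    then have y: "y \<in> carrier_mat n n" by (auto simp: nilpotents_def dest: pp_carrier)
    have gc: "g \<in> carrier_mat n n" "inv\<^bsub>SL_group n\<^esub> g \<in> carrier_mat n n"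
      using subgroup.subset[OF K] g subgroup.m_inv_closed[OF K g] by (auto simp: SL_group_def)
    show "conj_act n g y \<in> carrier_mat n n"
      using gc y by (auto simp: conj_act_def intro!: mult_carrier_mat[of _ n n _ n])
    show cc: "conj_act n g e \<in> carrier_mat n n"
      using gc e by (auto simp: conj_act_def intro!: mult_carrier_mat[of _ n n _ n])
    have "V.rank (conj_act n g e) \<le> V.rank e"
      unfolding conj_act_def by (rule V.rank_mult_le[OF e gc])
    then have "V.rank (conj_act n g e + M) < n"
      using V.rank_subadditive[OF cc M(1)] less by simp
    then show "det (fst (conj_act n g e, conj_act n g y) + M) = 0"
      using V.det_rank_iff[OF add_carrier_mat[OF M(1)], of "conj_act n g e"] by auto
  qed
  then have "C_variety n \<theta> K e \<subseteq> {p \<in> carrier_mat n n \<times> carrier_mat n n. det (fst p + M) = 0}"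
    unfolding C_variety_def by (rule closure_of_minimal) (rule closedin_pair_det[OF M(1)])
  with p M(2) show False by auto
qed

text \<open>In type AII the sign rule comes from expanding \<Phi>(u + v, u + v) = 0.\<close>

lemma type_AI_AII_form:
  fixes \<theta> :: "'k::field mat \<Rightarrow> 'k mat"
  assumes "type_AI n \<theta> \<or> type_AII n \<theta>"
  obtains \<Phi> \<epsilon> where "bilinear_form n \<Phi>" "nondegenerate_form n \<Phi>" "eigenspaces_from_form n \<theta> \<Phi>"
    "\<epsilon> = 1 \<or> \<epsilon> = - 1"
    "\<And>u v. u \<in> carrier_vec n \<Longrightarrow> v \<in> carrier_vec n \<Longrightarrow> \<Phi> u v = \<epsilon> * \<Phi> v u"
  using assms
proof
  assume "type_AI n \<theta>"
  then obtain \<Phi> where "bilinear_form n \<Phi>" "nondegenerate_form n \<Phi>" "symmetric_form n \<Phi>"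
    "eigenspaces_from_form n \<theta> \<Phi>"
    unfolding type_AI_def by blast
  then show thesis
    using that[of \<Phi> 1] unfolding symmetric_form_def by simp
next
  assume "type_AII n \<theta>"
  then obtain \<Phi> where b: "bilinear_form n \<Phi>" and nd: "nondegenerate_form n \<Phi>"
    and alt: "alternating_form n \<Phi>" and ei: "eigenspaces_from_form n \<theta> \<Phi>"
    unfolding type_AII_def by blast
  have "\<Phi> u v = - 1 * \<Phi> v u" if u: "u \<in> carrier_vec n" and v: "v \<in> carrier_vec n" for u v
  proof -
    have add: "\<Phi> (u + v) w = \<Phi> u w + \<Phi> v w" "\<Phi> w (u + v) = \<Phi> w u + \<Phi> w v" if "w \<in> carrier_vec n" for w
      using b that u v unfolding bilinear_form_def by blast+
    have z: "\<Phi> w w = 0" if "w \<in> carrier_vec n" for w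
      using alt that unfolding alternating_form_def by blast
    have "\<Phi> u v + \<Phi> v u = 0"
      using z[of "u + v"] z[OF u] z[OF v] add(1)[of "u + v"] add(2)[OF u] add(2)[OF v] u v by simp
    then show ?thesis by (simp add: eq_neg_iff_add_eq_0)
  qed
  then show thesis using that[of \<Phi> "- 1"] b nd ei by blast
qed

theorem mainTheorem6:
  fixes n :: nat
    and \<theta> :: "'k::{alg_closed_field, field_char_0} mat \<Rightarrow> 'k mat"
    and K :: "'k mat set"
    and e :: "'k mat"
    and ls :: "nat list"
  assumes "nontrivial_involution n \<theta>"
    and "type_AI n \<theta> \<or> type_AII n \<theta>"
    and "connected_algebraic_subgroup n K"
    and "lie_algebra_of n K = kk n \<theta>"
    and "e \<in> nilpotents n \<theta>"
    and "e \<noteq> 0\<^sub>m n n"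
    and "almost_pp_distinguished n \<theta> e"
    and "young_diagram_rows e ls"
    and "\<exists>i1 < length ls. \<exists>i2 < length ls. 0 < ls ! i1 \<and> ls ! i1 + 1 = ls ! i2"
  shows "\<not> irreducible_component (mat_pair_zariski n) (nil_commuting_variety n \<theta>)
           (C_variety n \<theta> K e)"
proof
  let ?C = "C_variety n \<theta> K e"
  assume comp: "irreducible_component (mat_pair_zariski n) (nil_commuting_variety n \<theta>) ?C"
  obtain \<Phi> \<epsilon> where \<Phi>: "bilinear_form n \<Phi>" "nondegenerate_form n \<Phi>"
    and eigen: "eigenspaces_from_form n \<theta> \<Phi>" and \<epsilon>: "\<epsilon> = 1 \<or> \<epsilon> = - 1"
    "\<And>u v. u \<in> carrier_vec n \<Longrightarrow> v \<in> carrier_vec n \<Longrightarrow> \<Phi> u v = \<epsilon> * \<Phi> v u"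
    by (rule type_AI_AII_form[OF assms(2)]) blast
  have pp_eq: "pp n \<theta> = {x \<in> sl n. \<forall>u\<in>carrier_vec n. \<forall>v\<in>carrier_vec n. \<Phi> (x *\<^sub>v u) v = \<Phi> u (x *\<^sub>v v)}"
    using eigen unfolding eigenspaces_from_form_def by blast
  have e_pp: "e \<in> pp n \<theta>" and e_nil: "nilpotent_mat e"
    using assms(5) unfolding nilpotents_def by auto
  have ec: "e \<in> carrier_mat n n" by (rule pp_carrier[OF e_pp])
  interpret self_adjoint_mat n \<Phi> \<epsilon> e
  proof
    show "\<Phi> (e *\<^sub>v u) v = \<Phi> u (e *\<^sub>v v)" if "u \<in> carrier_vec n" "v \<in> carrier_vec n" for u v
      using e_pp that unfolding pp_eq by blast
  qed (fact \<Phi> \<epsilon> ec)+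
  obtain n_as where nf: "jordan_nf e n_as" and ls: "ls = map fst n_as"
    using assms(8) unfolding young_diagram_rows_def by blast
  obtain i1 i2 where i: "i1 < length n_as" "i2 < length n_as"
    "0 < fst (n_as ! i1)" "fst (n_as ! i2) = Suc (fst (n_as ! i1))"
    using assms(9) unfolding ls by auto
  obtain y where yc: "y \<in> carrier_mat n n"
    and y_adj: "\<forall>u\<in>carrier_vec n. \<forall>v\<in>carrier_vec n. \<Phi> (y *\<^sub>v u) v = \<Phi> u (y *\<^sub>v v)"
    and y: "nilpotent_mat y" "mat_trace y = 0" "e * y = y * e"
    and rank: "vec_space.rank n e < vec_space.rank n (e + y)"
    using exists_commuting_rank_increase[OF e_nil nf i(1) refl i(3) i(2,4)] by blast
  have y_pp: "y \<in> pp n \<theta>"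
    unfolding pp_eq using yc y(2) y_adj by (simp add: sl_def)
  have K: "subgroup K (SL_group n)"
    using assms(3) unfolding connected_algebraic_subgroup_def by blast
  let ?S = "{(conj_act n g e, conj_act n g y) | g y. g \<in> K \<and> y \<in> nilpotents n \<theta> \<inter> pp_centralizer n \<theta> e}"
  \<comment> \<open>The identity of \<open>K\<close> shows that \<open>(e, y)\<close> itself is
    among the pairs whose closure is taken.\<close>
  have "1\<^sub>m n \<in> K"
    using subgroup.one_closed[OF K] by (simp add: SL_group_def)
  moreover have "y \<in> nilpotents n \<theta> \<inter> pp_centralizer n \<theta> e"
    using y y_pp lie_bracket_eq_0_iff[OF ec yc] by (simp add: nilpotents_def pp_centralizer_def)
  ultimately have "(e, y) \<in> ?S"
    using conj_act_one[OF ec] conj_act_one[OF yc] by force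
  moreover have "(e, y) \<in> topspace (mat_pair_zariski n)"
    using ec yc by (simp add: mat_pair_zariski_def)
  ultimately have ey: "(e, y) \<in> ?C"
    unfolding C_variety_def using closure_of_subset_Int[of "mat_pair_zariski n" ?S] by blast
  let ?Z = "{(x + t \<cdot>\<^sub>m y, y) | t x y. (x, y) \<in> ?C}"
  have sub: "?C \<subseteq> nil_commuting_variety n \<theta>" and irr: "irreducible_in (mat_pair_zariski n) ?C"
    and max: "\<And>Z. irreducible_in (mat_pair_zariski n) Z \<Longrightarrow> ?C \<subseteq> Z \<Longrightarrow> Z \<subseteq> nil_commuting_variety n \<theta> \<Longrightarrow> Z = ?C"
    using comp unfolding irreducible_component_def by blast+
  \<comment> \<open>Maximality of a component: the union of its shears is irreducible, contained in
    the variety, and contains the component through the parameter 0.\<close>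
  have "?Z = ?C"
  proof (rule max)
    show "irreducible_in (mat_pair_zariski n) ?Z" by (rule irreducible_in_shear[OF irr])
    show "?Z \<subseteq> nil_commuting_variety n \<theta>"
      using sub nil_commuting_variety_shear[OF assms(1)] by blast
    show "?C \<subseteq> ?Z"
    proof
      fix p assume p: "p \<in> ?C"
      obtain x y where xy: "p = (x, y)" by (cases p)
      have "x \<in> carrier_mat n n" "y \<in> carrier_mat n n"
        using p sub unfolding xy nil_commuting_variety_def nilpotents_def by (auto dest: pp_carrier)
      then have "x = x + 0 \<cdot>\<^sub>m y" by (intro eq_matI) auto
      then show "p \<in> ?Z" using p xy by blast
    qed
  qed
  \<comment> \<open>The shear of \<open>(e, y)\<close> with parameter 1 has a first coordinate whose
    rank exceeds that of \<open>e\<close>.\<close>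
  moreover have "(e + 1 \<cdot>\<^sub>m y, y) \<in> ?Z" using ey by blast
  moreover have "1 \<cdot>\<^sub>m y = y" by (intro eq_matI) auto
  ultimately have "(e + y, y) \<in> ?C" by simp
  from C_variety_rank_le[OF K ec this] rank show False by simp
qed

end
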